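(* Let $\mathcal{G}$ be a class of graphs for which there is a polynomial $p$ such that every $G\in\mathcal{G}$ has at most $p(|V(G)|)$ minimal vertex separators. Then Vertex Separator Reconfiguration on graphs of $\mathcal{G}$ can be solved in polynomial time under TAR and under TJ.
   Context: A minimal vertex separator of $G$ is a set that is a minimal $xy$-separator for some pair of distinct non-adjacent vertices $x,y$, where an $xy$-separator is $S\subseteq V(G)\setminus\{x,y\}$ with $x,y$ in different components of $G-S$, minimal if no proper subset is one. Vertex Separator Reconfiguration: given $G$, non-adjacent $s,t$, $st$-separators $S_a,S_b$ (for TAR also $k$ with $|S_a|,|S_b|\le k$; for TJ $|S_a|=|S_b|$), decide whether a sequence of $st$-separators from $S_a$ to $S_b$ exists with consecutive sets adjacent: TJ: $|S|=|S'|$, $|S\setminus S'|=|S'\setminus S|=1$; $k$-TAR: $|S\triangle S'|=1$, $\max(|S|,|S'|)\le k$. *)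

theory Defs
  imports
    "Graph_Theory.Digraph_Component"
    "HOL-Computational_Algebra.Polynomial"
begin

section \<open>Graphs and vertex separators\<close>

text \<open>
  A finite simple undirected graph is a \<^locale>\<open>pair_graph\<close>: a finite, loop-free digraph whose arc
  relation is symmetric. Strong components of a symmetric digraph are its connected components.
\<close>

definition del_verts :: "'a pair_pre_digraph \<Rightarrow> 'a set \<Rightarrow> ('a, 'a \<times> 'a) pre_digraph" where
  "del_verts G S = with_proj G \<restriction> (pverts G - S)"

definition components :: "('a, 'b) pre_digraph \<Rightarrow> 'a set set" where
  "components H = pre_digraph.sccs_verts H"

definition separator :: "'a pair_pre_digraph \<Rightarrow> 'a \<Rightarrow> 'a \<Rightarrow> 'a set \<Rightarrow> bool" where
  "separator G x y S \<longleftrightarrow>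
     S \<subseteq> pverts G - {x, y} \<and>
     (\<exists>C \<in> components (del_verts G S). \<exists>D \<in> components (del_verts G S).
        x \<in> C \<and> y \<in> D \<and> C \<noteq> D)"

definition minimal_separator :: "'a pair_pre_digraph \<Rightarrow> 'a \<Rightarrow> 'a \<Rightarrow> 'a set \<Rightarrow> bool" where
  "minimal_separator G x y S \<longleftrightarrow> separator G x y S \<and> (\<forall>S'. S' \<subset> S \<longrightarrow> \<not> separator G x y S')"

definition nonadjacent :: "'a pair_pre_digraph \<Rightarrow> 'a \<Rightarrow> 'a \<Rightarrow> bool" where
  "nonadjacent G x y \<longleftrightarrow> x \<in> pverts G \<and> y \<in> pverts G \<and> x \<noteq> y \<and> (x, y) \<notin> parcs G"

definition minimal_vertex_separators :: "'a pair_pre_digraph \<Rightarrow> 'a set set" where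
  "minimal_vertex_separators G = {S. \<exists>x y. nonadjacent G x y \<and> minimal_separator G x y S}"


section \<open>Vertex Separator Reconfiguration\<close>

definition tj_adjacent :: "'a set \<Rightarrow> 'a set \<Rightarrow> bool" where
  "tj_adjacent S S' \<longleftrightarrow> card S = card S' \<and> card (S - S') = 1 \<and> card (S' - S) = 1"

definition tar_adjacent :: "nat \<Rightarrow> 'a set \<Rightarrow> 'a set \<Rightarrow> bool" where
  "tar_adjacent k S S' \<longleftrightarrow> card (sym_diff S S') = 1 \<and> max (card S) (card S') \<le> k"

definition reconfigurable ::
  "('a set \<Rightarrow> 'a set \<Rightarrow> bool) \<Rightarrow> 'a pair_pre_digraph \<Rightarrow> 'a \<Rightarrow> 'a \<Rightarrow> 'a set \<Rightarrow> 'a set \<Rightarrow> bool"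
where
  "reconfigurable adj G s t A B \<longleftrightarrow>
     (\<exists>Ss. Ss \<noteq> [] \<and> hd Ss = A \<and> last Ss = B \<and>
           (\<forall>S \<in> set Ss. separator G s t S) \<and> successively adj Ss)"

type_synonym tj_instance = "nat pair_pre_digraph \<times> nat \<times> nat \<times> nat set \<times> nat set"
type_synonym tar_instance = "nat pair_pre_digraph \<times> nat \<times> nat \<times> nat set \<times> nat set \<times> nat"

definition tj_instances :: "nat pair_pre_digraph set \<Rightarrow> tj_instance set" where
  "tj_instances \<G> = {(G, s, t, A, B). G \<in> \<G> \<and> nonadjacent G s t \<and>
     separator G s t A \<and> separator G s t B \<and> card A = card B}"

definition tar_instances :: "nat pair_pre_digraph set \<Rightarrow> tar_instance set" where
  "tar_instances \<G> = {(G, s, t, A, B, k). G \<in> \<G> \<and> nonadjacent G s t \<and>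
     separator G s t A \<and> separator G s t B \<and> card A \<le> k \<and> card B \<le> k}"

fun tj_yes :: "tj_instance \<Rightarrow> bool" where
  "tj_yes (G, s, t, A, B) \<longleftrightarrow> reconfigurable tj_adjacent G s t A B"

fun tar_yes :: "tar_instance \<Rightarrow> bool" where
  "tar_yes (G, s, t, A, B, k) \<longleftrightarrow> reconfigurable (tar_adjacent k) G s t A B"


section \<open>Polynomial-time computation\<close>

text \<open>
  The machine model is first-order recursive programs over binary trees (pure Lisp with a single
  atom), cf. Jones, \<^emph>\<open>Computability and Complexity from a Programming Perspective\<close> (1997). Every
  step is a constant-time pointer operation: values may be shared, calls only need a control
  stack, and the only test is whether a value is the atom; in particular there is no primitive
  equality test on trees and no primitive arithmetic. Running times therefore agree with those of
  Turing machines up to a polynomial.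
\<close>

datatype data = Atom | Pair data data

fun left :: "data \<Rightarrow> data" where
  "left Atom = Atom"
| "left (Pair a b) = a"

fun right :: "data \<Rightarrow> data" where
  "right Atom = Atom"
| "right (Pair a b) = b"

text \<open>
  Variables are de Bruijn indices into the list of local values. A program is a finite list of
  bodies of unary functions, and \<open>Call f e\<close> calls the function at position \<open>f\<close>.
\<close>

datatype expr =
    Var nat
  | Const_Atom
  | Mk_Pair expr expr
  | Left expr
  | Right expr
  | If_Atom expr expr expr
  | Bind expr expr
  | Call nat expr

type_synonym program = "expr list"

text \<open>\<open>eval P env e v n\<close>: expression \<open>e\<close> evaluates to \<open>v\<close> in exactly \<open>n\<close> steps.\<close>

inductive eval :: "program \<Rightarrow> data list \<Rightarrow> expr \<Rightarrow> data \<Rightarrow> nat \<Rightarrow> bool" for P :: program where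
  eval_Var: "i < length env \<Longrightarrow> eval P env (Var i) (env ! i) 1"
| eval_Const_Atom: "eval P env Const_Atom Atom 1"
| eval_Mk_Pair: "eval P env e1 v1 n1 \<Longrightarrow> eval P env e2 v2 n2 \<Longrightarrow>
    eval P env (Mk_Pair e1 e2) (Pair v1 v2) (n1 + n2 + 1)"
| eval_Left: "eval P env e v n \<Longrightarrow> eval P env (Left e) (left v) (n + 1)"
| eval_Right: "eval P env e v n \<Longrightarrow> eval P env (Right e) (right v) (n + 1)"
| eval_If_Atom: "eval P env e Atom n \<Longrightarrow> eval P env e1 v m \<Longrightarrow>
    eval P env (If_Atom e e1 e2) v (n + m + 1)"
| eval_If_Pair: "eval P env e (Pair a b) n \<Longrightarrow> eval P env e2 v m \<Longrightarrow>
    eval P env (If_Atom e e1 e2) v (n + m + 1)"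
| eval_Bind: "eval P env e1 w n \<Longrightarrow> eval P (w # env) e2 v m \<Longrightarrow>
    eval P env (Bind e1 e2) v (n + m + 1)"
| eval_Call: "eval P env e w n \<Longrightarrow> f < length P \<Longrightarrow> eval P [w] (P ! f) v m \<Longrightarrow>
    eval P env (Call f e) v (n + m + 1)"

inductive_cases eval_VarE: "eval P env (Var i) v n"
inductive_cases eval_Const_AtomE: "eval P env Const_Atom v n"
inductive_cases eval_Mk_PairE: "eval P env (Mk_Pair e1 e2) v n"
inductive_cases eval_LeftE: "eval P env (Left e) v n"
inductive_cases eval_RightE: "eval P env (Right e) v n"
inductive_cases eval_If_AtomE: "eval P env (If_Atom e e1 e2) v n"
inductive_cases eval_BindE: "eval P env (Bind e1 e2) v n"
inductive_cases eval_CallE: "eval P env (Call f e) v n"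

lemma eval_deterministic:
  "eval P env e v n \<Longrightarrow> eval P env e v' n' \<Longrightarrow> v' = v \<and> n' = n"
proof (induction arbitrary: v' n' rule: eval.induct)
  case eval_Var then show ?case by (auto elim: eval_VarE)
next
  case eval_Const_Atom then show ?case by (auto elim: eval_Const_AtomE)
next
  case eval_Mk_Pair from eval_Mk_Pair.prems show ?case
    by (auto elim!: eval_Mk_PairE dest!: eval_Mk_Pair.IH)
next
  case eval_Left from eval_Left.prems show ?case
    by (auto elim!: eval_LeftE dest!: eval_Left.IH)
next
  case eval_Right from eval_Right.prems show ?case
    by (auto elim!: eval_RightE dest!: eval_Right.IH)
next
  case eval_If_Atom from eval_If_Atom.prems show ?case
    by (auto elim!: eval_If_AtomE dest!: eval_If_Atom.IH)
next
  case eval_If_Pair from eval_If_Pair.prems show ?case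
    by (auto elim!: eval_If_AtomE dest!: eval_If_Pair.IH)
next
  case eval_Bind from eval_Bind.prems show ?case
    by (auto elim!: eval_BindE dest!: eval_Bind.IH)
next
  case eval_Call from eval_Call.prems show ?case
    by (auto elim!: eval_CallE dest!: eval_Call.IH)
qed

text \<open>
  A decision problem consists of a set \<open>I\<close> of legal instances, a relation \<open>enc\<close> between instances
  and their encodings, and the predicate \<open>yes\<close> to be decided. An instance may have several
  encodings; the program must be correct and fast on each of them. Nothing is required on
  inputs that encode no legal instance. The program is started in its function number 0 and
  rejects by returning the atom; \<open>size\<close> counts the inner nodes of the input tree.
\<close>

definition poly_time_solvable :: "'i set \<Rightarrow> ('i \<Rightarrow> data \<Rightarrow> bool) \<Rightarrow> ('i \<Rightarrow> bool) \<Rightarrow> bool" where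
  "poly_time_solvable I enc yes \<longleftrightarrow>
     (\<exists>(P :: program) (q :: nat poly). \<forall>i \<in> I. \<forall>d. enc i d \<longrightarrow>
        (\<exists>v n. eval P [d] (Call 0 (Var 0)) v n \<and> n \<le> poly q (size d) \<and> (v \<noteq> Atom \<longleftrightarrow> yes i)))"


section \<open>Encoding of instances\<close>

text \<open>Numbers are encoded in binary, least significant bit first.\<close>

fun enc_nat :: "nat \<Rightarrow> data" where
  "enc_nat n = (if n = 0 then Atom
     else Pair (if odd n then Pair Atom Atom else Atom) (enc_nat (n div 2)))"

declare enc_nat.simps [simp del]

definition enc_arc :: "nat \<times> nat \<Rightarrow> data" where
  "enc_arc a = Pair (enc_nat (fst a)) (enc_nat (snd a))"

definition enc_list :: "('a \<Rightarrow> data) \<Rightarrow> 'a list \<Rightarrow> data" where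
  "enc_list f xs = foldr (\<lambda>x d. Pair (f x) d) xs Atom"

definition encodes_set :: "('a \<Rightarrow> data) \<Rightarrow> 'a set \<Rightarrow> data \<Rightarrow> bool" where
  "encodes_set f A d \<longleftrightarrow> (\<exists>xs. distinct xs \<and> set xs = A \<and> d = enc_list f xs)"

definition encodes_graph :: "nat pair_pre_digraph \<Rightarrow> data \<Rightarrow> bool" where
  "encodes_graph G d \<longleftrightarrow>
     (\<exists>v a. encodes_set enc_nat (pverts G) v \<and> encodes_set enc_arc (parcs G) a \<and> d = Pair v a)"

fun encodes_tj :: "tj_instance \<Rightarrow> data \<Rightarrow> bool" where
  "encodes_tj (G, s, t, A, B) d \<longleftrightarrow>
     (\<exists>g a b. encodes_graph G g \<and> encodes_set enc_nat A a \<and> encodes_set enc_nat B b \<and>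
        d = Pair g (Pair (enc_nat s) (Pair (enc_nat t) (Pair a b))))"

fun encodes_tar :: "tar_instance \<Rightarrow> data \<Rightarrow> bool" where
  "encodes_tar (G, s, t, A, B, k) d \<longleftrightarrow>
     (\<exists>d'. encodes_tj (G, s, t, A, B) d' \<and> d = Pair (enc_nat k) d')"

end

theory Submission
  imports Defs
begin

text \<open>
  Write \<open>C_t(S)\<close> for the component of \<open>t\<close> in \<open>G - S\<close>. If \<open>S\<close> is a minimal \<open>st\<close>-separator and
  \<open>x \<in> S\<close> is not adjacent to \<open>t\<close>, then the neighbourhood of the component of \<open>t\<close> in
  \<open>G - (S \<union> N(x))\<close> is again a minimal \<open>st\<close>-separator, with a strictly smaller \<open>C_t\<close>. Starting from
  the neighbourhood of the component of \<open>t\<close> in \<open>G - N(s)\<close>, every minimal \<open>st\<close>-separator is reached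
  after at most \<open>|V(G)|\<close> such steps, and only minimal separators occur on the way; hence
  \<open>|V(G)|\<close> rounds of closing a duplicate-free list under these steps enumerate all of them in
  polynomial time.

  Every set in a reconfiguration sequence contains a minimal separator, and two consecutive sets
  of a \<open>k\<close>-TAR sequence have a union of size at most \<open>k\<close> (at most \<open>k + 1\<close> for a TJ sequence of
  \<open>k\<close>-sets). Conversely one can move between supersets of \<open>X\<close> and \<open>Y\<close> as soon as \<open>X \<union> Y\<close> is that
  small. So it suffices to decide connectivity in the graph whose vertices are \<open>S_a\<close>, \<open>S_b\<close> and the
  minimal separators of size at most \<open>k\<close>, joined if their union is small enough.

  The running time is controlled by closure properties of the class of functions on trees
  computable within polynomial time and output size; apart from the
  equality test on trees, the only loops are left folds over lists.
\<close>

section \<open>Polynomial-time functions on binary trees\<close>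

subsection \<open>Linking programs\<close>

text \<open>Locals are indexed from the head, so values added at the tail stay invisible.\<close>

lemma eval_append_env: "eval P env e v n \<Longrightarrow> eval P (env @ env') e v n"
proof (induction rule: eval.induct)
  case (eval_Var i env)
  then show ?case
    using eval.eval_Var[of i "env @ env'" P] by (simp add: nth_append)
next
  case (eval_Bind env e1 w n e2 v m)
  then show ?case by (intro eval.eval_Bind) auto
next
  case (eval_Call env e w n f v m)
  then show ?case by (intro eval.eval_Call) auto
qed (blast intro: eval.intros)+

lemma eval_append_program: "eval P env e v n \<Longrightarrow> eval (P @ Q) env e v n"
proof (induction rule: eval.induct)
  case (eval_Call env e w n f v m)
  then show ?case
    by (intro eval.eval_Call[where w = w]) (auto simp: nth_append)
qed (blast intro: eval.intros)+

text \<open>Functions are addressed by position; renumbering the calls lets a program be placed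
  behind another one without changing its behaviour.\<close>

primrec shift_calls :: "nat \<Rightarrow> expr \<Rightarrow> expr" where
  "shift_calls k (Var i) = Var i"
| "shift_calls k Const_Atom = Const_Atom"
| "shift_calls k (Mk_Pair e1 e2) = Mk_Pair (shift_calls k e1) (shift_calls k e2)"
| "shift_calls k (Left e) = Left (shift_calls k e)"
| "shift_calls k (Right e) = Right (shift_calls k e)"
| "shift_calls k (If_Atom e e1 e2) =
     If_Atom (shift_calls k e) (shift_calls k e1) (shift_calls k e2)"
| "shift_calls k (Bind e1 e2) = Bind (shift_calls k e1) (shift_calls k e2)"
| "shift_calls k (Call f e) = Call (k + f) (shift_calls k e)"

lemma eval_shift_calls:
  "eval P env e v n \<Longrightarrow>
   eval (Q @ map (shift_calls (length Q)) P) env (shift_calls (length Q) e) v n"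
proof (induction rule: eval.induct)
  case (eval_Call env e w n f v m)
  then show ?case
    unfolding shift_calls.simps by (intro eval.eval_Call[where w = w]) (auto simp: nth_append)
qed (unfold shift_calls.simps, (blast intro: eval.intros)+)

lemma eval_Left': "eval P env e v n \<Longrightarrow> w = left v \<Longrightarrow> m = n + 1 \<Longrightarrow> eval P env (Left e) w m"
  by (metis eval.intros(4,5))

lemma eval_Right': "eval P env e v n \<Longrightarrow> w = right v \<Longrightarrow> m = n + 1 \<Longrightarrow> eval P env (Right e) w m"
  by (metis eval.intros(4,5))

lemma eval_Var0: "eval P (d # env) (Var 0) d 1"
  using eval_Var[of 0 "d # env" P] by simp


subsection \<open>Polynomial bounds\<close>

text \<open>A single power suffices: the base is at least 2, so constants and sums are absorbed by a
  larger exponent. The set \<open>D\<close> confines the bound to the inputs that matter, which is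
  how the bound on the number of separators will enter.\<close>

definition poly_bounded :: "data set \<Rightarrow> (data \<Rightarrow> nat) \<Rightarrow> bool" where
  "poly_bounded D g \<longleftrightarrow> (\<exists>c. \<forall>d \<in> D. g d \<le> (size d + 2) ^ c)"

lemma poly_bounded_mono:
  assumes "poly_bounded D h" and "\<And>d. d \<in> D \<Longrightarrow> g d \<le> h d"
  shows "poly_bounded D g"
  using assms unfolding poly_bounded_def by (meson order_trans)

lemma poly_bounded_const [intro!, simp]: "poly_bounded D (\<lambda>_. k)"
proof -
  have "k \<le> (size d + 2) ^ k" for d :: data
  proof -
    have "k \<le> 2 ^ k" by (simp add: less_imp_le)
    also have "\<dots> \<le> (size d + 2) ^ k" by (rule power_mono) auto
    finally show ?thesis .
  qed
  then show ?thesis unfolding poly_bounded_def by blast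
qed

lemma poly_bounded_size [intro!, simp]: "poly_bounded D size"
  unfolding poly_bounded_def by (rule exI[of _ 1]) auto

lemma poly_bounded_mult:
  assumes "poly_bounded D g" "poly_bounded D h"
  shows "poly_bounded D (\<lambda>d. g d * h d)"
proof -
  obtain a b where "\<forall>d \<in> D. g d \<le> (size d + 2) ^ a" "\<forall>d \<in> D. h d \<le> (size d + 2) ^ b"
    using assms unfolding poly_bounded_def by blast
  then have "\<forall>d \<in> D. g d * h d \<le> (size d + 2) ^ (a + b)"
    by (simp add: power_add mult_mono)
  then show ?thesis unfolding poly_bounded_def by blast
qed

lemma poly_bounded_add:
  assumes "poly_bounded D g" "poly_bounded D h"
  shows "poly_bounded D (\<lambda>d. g d + h d)"
proof (rule poly_bounded_mono)
  have *: "poly_bounded D (\<lambda>d. f d + 1)" if f: "poly_bounded D f" for f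
  proof -
    obtain a where a: "\<forall>d \<in> D. f d \<le> (size d + 2) ^ a"
      using f unfolding poly_bounded_def by blast
    have "f d + 1 \<le> (size d + 2) ^ (a + 1)" if "d \<in> D" for d
    proof -
      have "f d + 1 \<le> (size d + 2) ^ a + (size d + 2) ^ a"
        using a that by (intro add_mono) auto
      also have "\<dots> \<le> (size d + 2) ^ (a + 1)" by simp
      finally show ?thesis .
    qed
    then show ?thesis unfolding poly_bounded_def by blast
  qed
  \<comment> \<open>Sums reduce to products, and adding 1 costs at most one more factor of the
    base.\<close>
  show "poly_bounded D (\<lambda>d. (g d + 1) * (h d + 1))"
    by (intro poly_bounded_mult * assms)
qed simp

lemma poly_bounded_power:
  "poly_bounded D g \<Longrightarrow> poly_bounded D (\<lambda>d. g d ^ k)"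
  by (induction k) (auto intro: poly_bounded_mult)

lemma poly_bounded_compose:
  assumes "poly_bounded D' g" "poly_bounded D (\<lambda>d. size (f d))" "f ` D \<subseteq> D'"
  shows "poly_bounded D (\<lambda>d. g (f d))"
proof -
  obtain c where "\<forall>d \<in> D'. g d \<le> (size d + 2) ^ c"
    using assms(1) unfolding poly_bounded_def by blast
  then have "\<And>d. d \<in> D \<Longrightarrow> g (f d) \<le> (size (f d) + 2) ^ c"
    using assms(3) by blast
  moreover have "poly_bounded D (\<lambda>d. (size (f d) + 2) ^ c)"
    by (intro poly_bounded_power poly_bounded_add poly_bounded_const assms(2))
  ultimately show ?thesis by (rule poly_bounded_mono[rotated])
qed

lemmas poly_bounded_intros =
  poly_bounded_const poly_bounded_size poly_bounded_add poly_bounded_mult poly_bounded_power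


subsection \<open>Closure properties\<close>

text \<open>
  Because values are shared, a value computed in polynomially many steps may have exponential
  size; the size bound is therefore a separate requirement.
\<close>

definition ptime :: "data set \<Rightarrow> (data \<Rightarrow> data) \<Rightarrow> bool" where
  "ptime D f \<longleftrightarrow> poly_bounded D (\<lambda>d. size (f d)) \<and>
     (\<exists>P e T. poly_bounded D T \<and> (\<forall>d \<in> D. \<exists>n \<le> T d. eval P [d] e (f d) n))"

lemma ptimeI:
  assumes "poly_bounded D (\<lambda>d. size (f d))" "poly_bounded D T"
    and "\<And>d. d \<in> D \<Longrightarrow> eval P [d] e (f d) (T d)"
  shows "ptime D f"
  using assms unfolding ptime_def by blast

lemma ptime_size: "ptime D f \<Longrightarrow> poly_bounded D (\<lambda>d. size (f d))"
  unfolding ptime_def by blast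

lemma ptime_id: "ptime D (\<lambda>d. d)"
  by (rule ptimeI[of _ _ "\<lambda>_. 1" "[]" "Var 0"]) (use poly_bounded_size eval_Var0 in auto)

lemma ptime_Atom: "ptime D (\<lambda>_. Atom)"
  by (rule ptimeI[of _ _ "\<lambda>_. 1" "[]" Const_Atom]) (use eval_Const_Atom in auto)

lemma ptime_cong: "ptime D f \<Longrightarrow> (\<And>d. d \<in> D \<Longrightarrow> f d = g d) \<Longrightarrow> ptime D g"
  unfolding ptime_def poly_bounded_def by auto

text \<open>Two expressions can be combined only if they run against one function table, so the
  second program is appended to the first with its calls renumbered.\<close>

lemma ptime_linked:
  assumes "ptime D f" "ptime D' g"
  obtains P e1 e2 T1 T2 where
    "poly_bounded D T1" "\<And>d. d \<in> D \<Longrightarrow> \<exists>n \<le> T1 d. eval P [d] e1 (f d) n"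
    "poly_bounded D' T2" "\<And>d. d \<in> D' \<Longrightarrow> \<exists>n \<le> T2 d. eval P [d] e2 (g d) n"
proof -
  obtain P1 e1 T1 where 1: "poly_bounded D T1" "\<And>d. d \<in> D \<Longrightarrow> \<exists>n \<le> T1 d. eval P1 [d] e1 (f d) n"
    using assms(1) unfolding ptime_def by blast
  obtain P2 e2 T2 where 2: "poly_bounded D' T2" "\<And>d. d \<in> D' \<Longrightarrow> \<exists>n \<le> T2 d. eval P2 [d] e2 (g d) n"
    using assms(2) unfolding ptime_def by blast
  show thesis
  proof
    show "\<exists>n \<le> T1 d. eval (P1 @ map (shift_calls (length P1)) P2) [d] e1 (f d) n" if "d \<in> D" for d
      using 1(2)[OF that] eval_append_program by blast
    show "\<exists>n \<le> T2 d. eval (P1 @ map (shift_calls (length P1)) P2) [d]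
        (shift_calls (length P1) e2) (g d) n" if "d \<in> D'" for d
      using 2(2)[OF that] eval_shift_calls by blast
  qed (use 1 2 in auto)
qed

lemma ptime_Pair:
  assumes f: "ptime D f" and g: "ptime D g"
  shows "ptime D (\<lambda>d. Pair (f d) (g d))"
proof -
  obtain P e1 e2 T1 T2 where *:
    "poly_bounded D T1" "\<And>d. d \<in> D \<Longrightarrow> \<exists>n \<le> T1 d. eval P [d] e1 (f d) n"
    "poly_bounded D T2" "\<And>d. d \<in> D \<Longrightarrow> \<exists>n \<le> T2 d. eval P [d] e2 (g d) n"
    using ptime_linked[OF assms] by metis
  have "\<exists>n \<le> T1 d + T2 d + 1. eval P [d] (Mk_Pair e1 e2) (Pair (f d) (g d)) n" if d: "d \<in> D" for d
    using *(2,4)[OF d] by (meson add_mono eval_Mk_Pair order_refl)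
  moreover have "poly_bounded D (\<lambda>d. T1 d + T2 d + 1)"
    by (intro poly_bounded_intros *)
  moreover have "poly_bounded D (\<lambda>d. size (Pair (f d) (g d)))"
    unfolding data.size by (intro poly_bounded_intros ptime_size f g)
  ultimately show ?thesis unfolding ptime_def by blast
qed

text \<open>\<open>Bind\<close> puts \<open>f d\<close> in front of the environment;
  \<open>e2\<close> already runs in \<open>[f d]\<close> and ignores the tail. Its time is
  polynomial in \<open>size d\<close> because \<open>size (f d)\<close> is.\<close>

lemma ptime_compose:
  assumes f: "ptime D f" and g: "ptime D' g" and sub: "f ` D \<subseteq> D'"
  shows "ptime D (\<lambda>d. g (f d))"
proof -
  obtain P e1 e2 T1 T2 where *:
    "poly_bounded D T1" "\<And>d. d \<in> D \<Longrightarrow> \<exists>n \<le> T1 d. eval P [d] e1 (f d) n"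
    "poly_bounded D' T2" "\<And>d. d \<in> D' \<Longrightarrow> \<exists>n \<le> T2 d. eval P [d] e2 (g d) n"
    using ptime_linked[OF f g] by metis
  have "\<exists>n \<le> T1 d + T2 (f d) + 1. eval P [d] (Bind e1 e2) (g (f d)) n" if d: "d \<in> D" for d
  proof -
    obtain n1 n2 where "n1 \<le> T1 d" "eval P [d] e1 (f d) n1"
        "n2 \<le> T2 (f d)" "eval P [f d] e2 (g (f d)) n2"
      using *(2)[OF d] *(4)[of "f d"] sub d by blast
    then show ?thesis
      using eval_append_env[of P "[f d]" e2 "g (f d)" n2 "[d]"]
      by (auto intro!: exI[of _ "n1 + n2 + 1"] eval_Bind)
  qed
  moreover have "poly_bounded D (\<lambda>d. T1 d + T2 (f d) + 1)"
    by (intro poly_bounded_intros * poly_bounded_compose[OF *(3) ptime_size[OF f] sub])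
  moreover have "poly_bounded D (\<lambda>d. size (g (f d)))"
    by (rule poly_bounded_compose[OF ptime_size[OF g] ptime_size[OF f] sub])
  ultimately show ?thesis unfolding ptime_def by blast
qed

lemma size_left_le: "size (left d) \<le> size d" and size_right_le: "size (right d) \<le> size d"
  by (cases d; simp)+

lemma ptime_left: "ptime D f \<Longrightarrow> ptime D (\<lambda>d. left (f d))"
proof (erule ptime_compose[OF _ _ subset_UNIV])
  show "ptime UNIV left"
    by (rule ptimeI[of _ _ "\<lambda>_. 2" "[]" "Left (Var 0)"])
      (auto intro!: poly_bounded_mono[OF poly_bounded_size] size_left_le eval_Left'[OF eval_Var0])
qed

lemma ptime_right: "ptime D f \<Longrightarrow> ptime D (\<lambda>d. right (f d))"
proof (erule ptime_compose[OF _ _ subset_UNIV])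
  show "ptime UNIV right"
    by (rule ptimeI[of _ _ "\<lambda>_. 2" "[]" "Right (Var 0)"])
      (auto intro!: poly_bounded_mono[OF poly_bounded_size] size_right_le eval_Right'[OF eval_Var0])
qed

lemma ptime_if:
  assumes f: "ptime D f" and g: "ptime D g" and h: "ptime D h"
  shows "ptime D (\<lambda>d. if f d = Atom then g d else h d)"
proof -
  \<comment> \<open>All three values are computed first and a fixed expression then selects one;
    this is affordable since each takes polynomial time on all of \<open>D\<close>.\<close>
  define G where "G d = Pair (f d) (Pair (g d) (h d))" for d
  have G: "ptime D G" unfolding G_def by (intro ptime_Pair assms)
  have "ptime UNIV (\<lambda>d. if left d = Atom then left (right d) else right (right d))"
  proof (rule ptimeI[of _ _ "\<lambda>_. 6" "[]"
        "If_Atom (Left (Var 0)) (Left (Right (Var 0))) (Right (Right (Var 0)))"])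
    show "poly_bounded UNIV (\<lambda>d. size (if left d = Atom then left (right d) else right (right d)))"
      by (rule poly_bounded_mono[OF poly_bounded_size])
        (auto intro: order_trans[OF size_left_le size_right_le] order_trans[OF size_right_le
            size_right_le])
    fix d
    show "eval [] [d] (If_Atom (Left (Var 0)) (Left (Right (Var 0))) (Right (Right (Var 0))))
       (if left d = Atom then left (right d) else right (right d)) 6"
    proof (cases "left d")
      case Atom
      have "eval [] [d] (If_Atom (Left (Var 0)) (Left (Right (Var 0))) (Right (Right (Var 0))))
       (left (right d)) (2 + 3 + 1)"
        by (intro eval_If_Atom eval_Left'[OF eval_Right'[OF eval_Var0]] eval_Left'[OF eval_Var0])
          (use Atom in auto)
      with Atom show ?thesis by simp
    next
      case (Pair a b)
      have "eval [] [d] (If_Atom (Left (Var 0)) (Left (Right (Var 0))) (Right (Right (Var 0))))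
       (right (right d)) (2 + 3 + 1)"
        by (rule eval_If_Pair[OF eval_Left'[OF eval_Var0] eval_Right'[OF eval_Right'[OF
            eval_Var0]]])
          (use Pair in auto)
      with Pair show ?thesis by simp
    qed
  qed auto
  then show ?thesis
    by (rule ptime_cong[OF ptime_compose[OF G _ subset_UNIV]]) (simp add: G_def)
qed

lemma poly_time_solvableI:
  assumes f: "ptime D f"
    and "\<And>i d. i \<in> I \<Longrightarrow> enc i d \<Longrightarrow> d \<in> D \<and> (f d \<noteq> Atom \<longleftrightarrow> yes i)"
  shows "poly_time_solvable I enc yes"
proof -
  obtain P e T where *: "poly_bounded D T" "\<And>d. d \<in> D \<Longrightarrow> \<exists>n \<le> T d. eval P [d] e (f d) n"
    using f unfolding ptime_def by blast
  \<comment> \<open>The result expression becomes function 0, so the calls into \<open>P\<close>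
    move up by one.\<close>
  define Q where "Q = [shift_calls 1 e] @ map (shift_calls 1) P"
  have "poly_bounded D (\<lambda>d. T d + 2)" by (intro poly_bounded_intros *)
  then obtain c where c: "\<And>d. d \<in> D \<Longrightarrow> T d + 2 \<le> (size d + 2) ^ c"
    unfolding poly_bounded_def by blast
  have "\<exists>n. eval Q [d] (Call 0 (Var 0)) (f d) n \<and> n \<le> poly ([:2, 1:] ^ c) (size d)" if d: "d \<in> D"
      for d
  proof -
    obtain n where n: "n \<le> T d" "eval P [d] e (f d) n" using *(2)[OF d] by blast
    have "eval Q [d] (shift_calls 1 e) (f d) n"
      using eval_shift_calls[OF n(2), of "[shift_calls 1 e]"] by (simp add: Q_def)
    then have "eval Q [d] (Call 0 (Var 0)) (f d) (1 + n + 1)"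
      by (intro eval_Call[OF eval_Var0]) (auto simp: Q_def)
    moreover have "1 + n + 1 \<le> poly ([:2, 1:] ^ c) (size d)"
      using n(1) c[OF d] by (simp add: poly_power add.commute)
    ultimately show ?thesis by blast
  qed
  then show ?thesis unfolding poly_time_solvable_def
    using assms(2) by blast
qed


subsection \<open>Folding over lists and testing equality\<close>

text \<open>A tree is read as a list along its right spine, so no tree is malformed as a
  list.\<close>

primrec elems :: "data \<Rightarrow> data list" where
  "elems Atom = []"
| "elems (Pair x xs) = x # elems xs"

definition dfold :: "(data \<Rightarrow> data \<Rightarrow> data) \<Rightarrow> data \<Rightarrow> data \<Rightarrow> data" where
  "dfold b l = fold b (elems l)"

lemma dfold_simps [simp]:
  "dfold b Atom a = a" "dfold b (Pair x xs) a = dfold b xs (b x a)"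
  by (simp_all add: dfold_def)

text \<open>The time of a loop body depends on the size of its accumulator, so all intermediate
  accumulators must be controlled, not only the last.\<close>

primrec accs_bounded :: "nat \<Rightarrow> (data \<Rightarrow> data \<Rightarrow> data) \<Rightarrow> data list \<Rightarrow> data \<Rightarrow> bool" where
  "accs_bounded M b [] a \<longleftrightarrow> size a \<le> M"
| "accs_bounded M b (x # xs) a \<longleftrightarrow> size a \<le> M \<and> accs_bounded M b xs (b x a)"

definition ptime2 :: "(data \<Rightarrow> data \<Rightarrow> data) \<Rightarrow> bool" where
  "ptime2 f \<longleftrightarrow> ptime UNIV (\<lambda>d. f (left d) (right d))"

definition ptime3 :: "(data \<Rightarrow> data \<Rightarrow> data \<Rightarrow> data) \<Rightarrow> bool" where
  "ptime3 f \<longleftrightarrow> ptime UNIV (\<lambda>d. f (left d) (left (right d)) (right (right d)))"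

lemma ptime2D: "ptime2 f \<Longrightarrow> ptime D g \<Longrightarrow> ptime D h \<Longrightarrow> ptime D (\<lambda>d. f (g d) (h d))"
  unfolding ptime2_def
  using ptime_compose[OF ptime_Pair[of D g h] _ subset_UNIV] by fastforce

text \<open>The loop is a tail call whose argument packs the remaining list, the accumulator and
  \<open>c\<close>. The parameter \<open>c\<close> replaces a closure, since functions are unary and
  first-order.\<close>

lemma ptime_dfold:
  assumes b: "ptime3 b" and l: "ptime D l" and a: "ptime D a" and c: "ptime D c"
    and M: "poly_bounded D M"
    and bound: "\<And>d. d \<in> D \<Longrightarrow> accs_bounded (M d) (\<lambda>x y. b x y (c d)) (elems (l d)) (a d)"
  shows "ptime D (\<lambda>d. dfold (\<lambda>x y. b x y (c d)) (l d) (a d))"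
proof -
  obtain P e T where T: "poly_bounded UNIV T"
    and ev: "\<And>d. \<exists>n \<le> T d. eval P [d] e (b (left d) (left (right d)) (right (right d))) n"
    using b unfolding ptime3_def ptime_def by blast
  obtain k where k: "\<And>d. T d \<le> (size d + 2) ^ k" using T unfolding poly_bounded_def by auto
  define f where "f = length P"
  define loop where "loop =
    If_Atom (Left (Var 0)) (Left (Right (Var 0)))
      (Call f (Mk_Pair (Right (Left (Var 0)))
        (Mk_Pair (Bind (Mk_Pair (Left (Left (Var 0))) (Right (Var 0))) e)
          (Right (Right (Var 0))))))"
  define Q where "Q = P @ [loop]"
  have Qf: "f < length Q" "Q ! f = loop" by (auto simp: Q_def f_def nth_append)
  \<comment> \<open>A round runs the body on \<open>Pair x (Pair a c)\<close>; its two pairs and the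
    2 of the base give the 4, and 30 covers the fixed overhead.\<close>
  have main: "\<exists>n \<le> (size l + 1) * ((size l + m + size c + 4) ^ k + 30).
      eval Q [Pair l (Pair a c)] loop (dfold (\<lambda>x y. b x y c) l a) n"
    if "accs_bounded m (\<lambda>x y. b x y c) (elems l) a" for l a c m
    using that
  proof (induction l arbitrary: a)
    case Atom
    have "eval Q [Pair Atom (Pair a c)] loop a (2 + 3 + 1)"
      unfolding loop_def
      by (intro eval_If_Atom eval_Left'[OF eval_Right'[OF eval_Var0]] eval_Left'[OF eval_Var0]) auto
    then show ?case by (auto intro!: exI[of _ "6::nat"])
  next
    case (Pair x xs)
    let ?p = "Pair (Pair x xs) (Pair a c)"
    let ?R = "(size xs + m + size c + 4) ^ k" and ?S = "(size (Pair x xs) + m + size c + 4) ^ k"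
    from Pair.prems have a: "size a \<le> m" and rest: "accs_bounded m (\<lambda>x y. b x y c) (elems xs) (b
        x a c)"
      by auto
    obtain n where n: "n \<le> (size xs + 1) * (?R + 30)"
      "eval Q [Pair xs (Pair (b x a c) c)] loop (dfold (\<lambda>x y. b x y c) xs (b x a c)) n"
      using Pair.IH(2)[OF rest] by blast
    obtain t where t: "t \<le> T (Pair x (Pair a c))" "eval P [Pair x (Pair a c)] e (b x a c) t"
      using ev[of "Pair x (Pair a c)"] by auto
    have "eval Q [Pair x (Pair a c), ?p] e (b x a c) t"
      using eval_append_env[OF eval_append_program[OF t(2)], of "[loop]" "[?p]"] by (simp add:
          Q_def)
    then have "eval Q [?p] (Bind (Mk_Pair (Left (Left (Var 0))) (Right (Var 0))) e) (b x a c)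
        ((3 + 2 + 1) + t + 1)"
      by (intro eval_Bind[OF eval_Mk_Pair[OF eval_Left'[OF eval_Left'[OF eval_Var0]]
          eval_Right'[OF eval_Var0]]]) auto
    then have "eval Q [?p] (Mk_Pair (Right (Left (Var 0)))
        (Mk_Pair (Bind (Mk_Pair (Left (Left (Var 0))) (Right (Var 0))) e)
          (Right (Right (Var 0))))) (Pair xs (Pair (b x a c) c)) (3 + (((3 + 2 + 1) + t + 1) + 3
              + 1) + 1)"
      by (intro eval_Mk_Pair eval_Right'[OF eval_Left'[OF eval_Var0]] eval_Right'[OF
          eval_Right'[OF eval_Var0]]) auto
    then have "eval Q [?p] (Call f (Mk_Pair (Right (Left (Var 0)))
        (Mk_Pair (Bind (Mk_Pair (Left (Left (Var 0))) (Right (Var 0))) e)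
          (Right (Right (Var 0)))))) (dfold (\<lambda>x y. b x y c) xs (b x a c))
          ((3 + (((3 + 2 + 1) + t + 1) + 3 + 1) + 1) + n + 1)"
      by (rule eval_Call) (use n Qf in auto)
    then have "eval Q [?p] loop (dfold (\<lambda>x y. b x y c) xs (b x a c))
          (2 + ((3 + (((3 + 2 + 1) + t + 1) + 3 + 1) + 1) + n + 1) + 1)"
      unfolding loop_def by (intro eval_If_Pair[of Q _ _ x xs] eval_Left'[OF eval_Var0]) auto
    moreover have "2 + ((3 + (((3 + 2 + 1) + t + 1) + 3 + 1) + 1) + n + 1) + 1
      \<le> (size (Pair x xs) + 1) * (?S + 30)"
    proof -
      have "t \<le> (size (Pair x (Pair a c)) + 2) ^ k" using t(1) k order_trans by blast
      also have "\<dots> \<le> ?S" by (rule power_mono) (use a in auto)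
      finally have "t \<le> ?S" .
      moreover have "?R \<le> ?S" by (rule power_mono) auto
      then have "n \<le> (size xs + 1) * (?S + 30)" using n(1)
        by (meson add_le_mono1 le_trans mult_le_mono2)
      ultimately have "2 + ((3 + (((3 + 2 + 1) + t + 1) + 3 + 1) + 1) + n + 1) + 1
        \<le> (size xs + 1) * (?S + 30) + (?S + 30)" by linarith
      also have "\<dots> = (size xs + 2) * (?S + 30)" by (simp add: algebra_simps)
      also have "\<dots> \<le> (size (Pair x xs) + 1) * (?S + 30)" by (intro mult_le_mono1) auto
      finally show ?thesis .
    qed
    ultimately show ?case unfolding dfold_simps by blast
  qed
  define G where "G d = Pair (l d) (Pair (a d) (c d))" for d
  define F where "F d = dfold (\<lambda>x y. b x y (right (right d))) (left d) (left (right d))" for d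
  have G: "ptime D G" unfolding G_def by (intro ptime_Pair l a c)
  have last: "size (dfold b l a) \<le> m" if "accs_bounded m b (elems l) a" for b l a m
    using that by (induction l arbitrary: a) auto
  have FG: "F (G d) = dfold (\<lambda>x y. b x y (c d)) (l d) (a d)" for d
    by (simp add: F_def G_def)
  obtain PG eG TG where TG: "poly_bounded D TG"
    and evG: "\<And>d. d \<in> D \<Longrightarrow> \<exists>n \<le> TG d. eval PG [d] eG (G d) n"
    using G unfolding ptime_def by blast
  define Z where "Z = Q @ map (shift_calls (length Q)) PG"
  define N where "N d = TG d + ((size (l d) + 1) * ((size (l d) + M d + size (c d) + 4) ^ k +
      30)) + 1" for d
  have "\<exists>n \<le> N d. eval Z [d] (Bind (shift_calls (length Q) eG) loop) (F (G d)) n" if d: "d \<in> D"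
      for d
  proof -
    obtain n1 where n1: "n1 \<le> TG d" "eval PG [d] eG (G d) n1" using evG[OF d] by blast
    obtain n2 where n2: "n2 \<le> (size (l d) + 1) * ((size (l d) + M d + size (c d) + 4) ^ k + 30)"
      "eval Q [G d] loop (F (G d)) n2"
      using main[OF bound[OF d]] unfolding FG by (auto simp: G_def)
    have "eval Z [d] (shift_calls (length Q) eG) (G d) n1"
      unfolding Z_def by (rule eval_shift_calls[OF n1(2)])
    moreover have "eval Z [G d, d] loop (F (G d)) n2"
      using eval_append_env[OF eval_append_program[OF n2(2)], of _ "[d]"] by (simp add: Z_def)
    ultimately have "eval Z [d] (Bind (shift_calls (length Q) eG) loop) (F (G d)) (n1 + n2 + 1)"
      by (rule eval_Bind)
    moreover have "n1 + n2 + 1 \<le> N d" using n1(1) n2(1) by (simp add: N_def)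
    ultimately show ?thesis by blast
  qed
  moreover have "poly_bounded D N"
    unfolding N_def by (intro poly_bounded_intros TG M ptime_size[OF l] ptime_size[OF c])
  moreover have "poly_bounded D (\<lambda>d. size (F (G d)))"
    by (rule poly_bounded_mono[OF M]) (use bound last in \<open>auto simp: FG\<close>)
  ultimately show ?thesis unfolding ptime_def FG by blast
qed

definition dbool :: "bool \<Rightarrow> data" where
  "dbool b = (if b then Pair Atom Atom else Atom)"

lemma dbool_eq_Atom [simp]: "dbool b = Atom \<longleftrightarrow> \<not> b"
  by (simp add: dbool_def)

definition deq :: "data \<Rightarrow> data \<Rightarrow> data" where
  "deq a b = dbool (a = b)"

text \<open>Equality is decided by simultaneous recursion on both trees. The time is linear in
  \<open>2 * size (left d) + 1\<close>, the number of nodes of the left tree with its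
  leaves.\<close>

lemma ptime2_deq: "ptime2 deq"
proof -
  define ll rr where "ll = Call 0 (Mk_Pair (Left (Left (Var 0))) (Left (Right (Var 0))))"
    and "rr = Call 0 (Mk_Pair (Right (Left (Var 0))) (Right (Right (Var 0))))"
  define body where "body =
    If_Atom (Left (Var 0)) (If_Atom (Right (Var 0)) (Mk_Pair Const_Atom Const_Atom) Const_Atom)
      (If_Atom (Right (Var 0)) Const_Atom (If_Atom ll Const_Atom rr))"
  have ev: "\<exists>n \<le> 40 * (2 * size (left d) + 1). eval [body] [d] body (deq (left d) (right d)) n"
      for d
  proof (induction "left d" arbitrary: d)
    case Atom
    show ?case
    proof (cases "right d")
      case Atom': Atom
      have "eval [body] [d] body (Pair Atom Atom) (2 + (2 + (1 + 1 + 1) + 1) + 1)"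
        unfolding body_def
        by (intro eval_If_Atom eval_Left'[OF eval_Var0] eval_Right'[OF eval_Var0] eval_Mk_Pair
            eval_Const_Atom)
          (use Atom Atom' in auto)
      then show ?thesis using Atom[symmetric] Atom' by (auto simp: deq_def dbool_def intro!:
          exI[of _ "9::nat"])
    next
      case (Pair y ys)
      have "eval [body] [d] body Atom (2 + (2 + 1 + 1) + 1)"
        unfolding body_def
        by (intro eval_If_Atom eval_If_Pair[of _ _ _ y ys] eval_Left'[OF eval_Var0]
            eval_Right'[OF eval_Var0] eval_Const_Atom)
          (use Atom Pair in auto)
      then show ?thesis using Atom[symmetric] Pair by (auto simp: deq_def dbool_def intro!:
          exI[of _ "7::nat"])
    qed
  next
    case (Pair x xs)
    show ?case
    proof (cases "right d")
      case Atom
      have "eval [body] [d] body Atom (2 + (2 + 1 + 1) + 1)"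
        unfolding body_def
        by (intro eval_If_Pair[of _ _ _ x xs] eval_If_Atom[OF _ eval_Const_Atom] eval_Left'[OF
            eval_Var0] eval_Right'[OF eval_Var0])
          (use Pair Atom in auto)
      then show ?thesis using Pair(3)[symmetric] Atom by (auto simp: deq_def dbool_def intro!:
          exI[of _ "7::nat"])
    next
      case R: (Pair y ys)
      obtain n1 where n1: "n1 \<le> 40 * (2 * size x + 1)" "eval [body] [Pair x y] body (deq x y) n1"
        using Pair(1)[of "Pair x y"] by auto
      obtain n2 where n2: "n2 \<le> 40 * (2 * size xs + 1)" "eval [body] [Pair xs ys] body (deq xs
          ys) n2"
        using Pair(2)[of "Pair xs ys"] by auto
      have ll: "eval [body] [d] ll (deq x y) ((3 + 3 + 1) + n1 + 1)"
        unfolding ll_def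
        by (rule eval_Call[OF eval_Mk_Pair[OF eval_Left'[OF eval_Left'[OF eval_Var0]]
             eval_Left'[OF eval_Right'[OF eval_Var0]]]])
         (use n1 Pair(3)[symmetric] R in auto)
      have rr: "eval [body] [d] rr (deq xs ys) ((3 + 3 + 1) + n2 + 1)"
        unfolding rr_def
        by (rule eval_Call[OF eval_Mk_Pair[OF eval_Right'[OF eval_Left'[OF eval_Var0]]
             eval_Right'[OF eval_Right'[OF eval_Var0]]]])
         (use n2 Pair(3)[symmetric] R in auto)
      have "\<exists>n \<le> (7 + n1 + 1) + (7 + n2 + 1) + 1.
         eval [body] [d] (If_Atom ll Const_Atom rr) (deq (Pair x xs) (Pair y ys)) n"
      proof (cases "x = y")
        case True
        then show ?thesis
          using eval_If_Pair[OF _ rr, of ll Atom Atom "(3 + 3 + 1) + n1 + 1" Const_Atom] ll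
          by (auto simp: deq_def dbool_def)
      next
        case False
        then show ?thesis
          using eval_If_Atom[OF _ eval_Const_Atom, of "[body]" "[d]" ll "(3 + 3 + 1) + n1 + 1"
              rr] ll
          by (auto simp: deq_def dbool_def intro!: exI[of _ "10 + n1"])
      qed
      then obtain n where n: "n \<le> (7 + n1 + 1) + (7 + n2 + 1) + 1"
         "eval [body] [d] (If_Atom ll Const_Atom rr) (deq (Pair x xs) (Pair y ys)) n" by blast
      have "eval [body] [d] body (deq (Pair x xs) (Pair y ys)) (2 + (2 + n + 1) + 1)"
        unfolding body_def
        by (intro eval_If_Pair[of _ _ "Left (Var 0)" x xs] eval_If_Pair[of _ _ "Right (Var 0)" y
            ys] n(2)[unfolded body_def] eval_Left'[OF eval_Var0] eval_Right'[OF eval_Var0])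
          (use Pair R in auto)
      moreover have "2 + (2 + n + 1) + 1 \<le> 40 * (2 * size (Pair x xs) + 1)"
        using n(1) n1(1) n2(1) by simp
      ultimately show ?thesis unfolding Pair(3)[symmetric] R by blast
    qed
  qed
  have "poly_bounded UNIV (\<lambda>d. size (deq (left d) (right d)))"
    by (rule poly_bounded_mono[OF poly_bounded_const[of _ 1]]) (simp add: deq_def dbool_def)
  moreover have "poly_bounded UNIV (\<lambda>d. 40 * (2 * size (left d) + 1))"
    by (intro poly_bounded_intros poly_bounded_mono[OF poly_bounded_size] size_left_le)
  ultimately show ?thesis
    using ev unfolding ptime2_def ptime_def by blast
qed


section \<open>Enumerating minimal separators\<close>

definition avoiding :: "('a \<times> 'a) set \<Rightarrow> 'a set \<Rightarrow> ('a \<times> 'a) set" where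
  "avoiding E X = {(u, v) \<in> E. u \<notin> X \<and> v \<notin> X}"

text \<open>For \<open>t\<close> outside \<open>X\<close> this is the component of \<open>t\<close>
  after deleting \<open>X\<close>. If \<open>t\<close> lies in \<open>X\<close>, no arc can be taken
  and the value is \<open>{t}\<close>, so \<open>comp_of_self\<close> and \<open>comp_of_sym\<close>
  hold unconditionally.\<close>

definition comp_of :: "('a \<times> 'a) set \<Rightarrow> 'a set \<Rightarrow> 'a \<Rightarrow> 'a set" where
  "comp_of E X t = (avoiding E X)\<^sup>* `` {t}"

definition nbrs :: "('a \<times> 'a) set \<Rightarrow> 'a set \<Rightarrow> 'a set" where
  "nbrs E C = E `` C - C"

text \<open>For \<open>t\<close> outside \<open>X\<close>, these are the vertices of
  \<open>X\<close> that border the component of \<open>t\<close>; dropping the others from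
  \<open>X\<close> leaves that component unchanged.\<close>

definition core :: "('a \<times> 'a) set \<Rightarrow> 'a \<Rightarrow> 'a set \<Rightarrow> 'a set" where
  "core E t X = nbrs E (comp_of E X t)"

locale st_graph =
  fixes V :: "'a set" and E :: "('a \<times> 'a) set" and s t :: 'a
  assumes finite_V: "finite V" and E_subset: "E \<subseteq> V \<times> V" and sym_E: "sym E"
    and s_V: "s \<in> V" and t_V: "t \<in> V" and s_neq_t: "s \<noteq> t" and not_adj: "(s, t) \<notin> E"
begin

definition is_sep :: "'a set \<Rightarrow> bool" where
  "is_sep S \<longleftrightarrow> S \<subseteq> V - {s, t} \<and> s \<notin> comp_of E S t"

definition is_minsep :: "'a set \<Rightarrow> bool" where
  "is_minsep S \<longleftrightarrow> is_sep S \<and> (\<forall>S'. S' \<subset> S \<longrightarrow> \<not> is_sep S')"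

section \<open>Components after deletion and full components of minimal separators\<close>

lemma E_sym: "(u, v) \<in> E \<Longrightarrow> (v, u) \<in> E"
  using sym_E by (auto simp: sym_def)

lemma sym_avoiding: "sym (avoiding E X)"
  using sym_E by (auto simp: sym_def avoiding_def)

lemma comp_of_sym: "u \<in> comp_of E X v \<longleftrightarrow> v \<in> comp_of E X u"
  unfolding comp_of_def using sym_rtrancl[OF sym_avoiding] by (auto dest: symD)

lemma comp_of_self [simp]: "v \<in> comp_of E X v"
  by (simp add: comp_of_def)

lemma comp_of_disjoint:
  assumes "v \<notin> X" shows "comp_of E X v \<inter> X = {}"
proof -
  have "u \<notin> X" if "(v, u) \<in> (avoiding E X)\<^sup>*" for u
    using that assms by (induction rule: rtrancl_induct) (auto simp: avoiding_def)
  then show ?thesis by (auto simp: comp_of_def)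
qed

lemma comp_of_subset: "v \<in> V \<Longrightarrow> comp_of E X v \<subseteq> V"
proof -
  assume "v \<in> V"
  have "u \<in> V" if "(v, u) \<in> (avoiding E X)\<^sup>*" for u
    using that \<open>v \<in> V\<close> E_subset by (induction rule: rtrancl_induct) (auto simp: avoiding_def)
  then show ?thesis by (auto simp: comp_of_def)
qed

lemma comp_of_step:
  "u \<in> comp_of E X v \<Longrightarrow> (u, w) \<in> E \<Longrightarrow> u \<notin> X \<Longrightarrow> w \<notin> X \<Longrightarrow> w \<in> comp_of E X v"
  unfolding comp_of_def by (auto simp: avoiding_def intro: rtrancl_into_rtrancl)

lemma comp_of_trans: "u \<in> comp_of E X v \<Longrightarrow> w \<in> comp_of E X u \<Longrightarrow> w \<in> comp_of E X v"
  unfolding comp_of_def by auto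

lemma comp_of_least:
  assumes "v \<in> C" and "\<And>u w. u \<in> C \<Longrightarrow> (u, w) \<in> E \<Longrightarrow> u \<notin> X \<Longrightarrow> w \<notin> X \<Longrightarrow> w \<in> C"
  shows "comp_of E X v \<subseteq> C"
proof -
  have "u \<in> C" if "(v, u) \<in> (avoiding E X)\<^sup>*" for u
    using that by (induction rule: rtrancl_induct) (use assms in \<open>auto simp: avoiding_def\<close>)
  then show ?thesis by (auto simp: comp_of_def)
qed

text \<open>Paths from \<open>v\<close> stay inside the component, so they survive the deletion of
  any set that misses it. This compares components for unrelated \<open>X\<close> and
  \<open>Y\<close>.\<close>

lemma comp_of_mono:
  assumes "comp_of E X v \<inter> Y = {}" shows "comp_of E X v \<subseteq> comp_of E Y v"
proof -
  have "u \<in> comp_of E Y v" if "(v, u) \<in> (avoiding E X)\<^sup>*" for u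
    using that
  proof (induction rule: rtrancl_induct)
    case base show ?case by simp
  next
    case (step u w)
    then have "u \<in> comp_of E X v" "w \<in> comp_of E X v" by (auto simp: comp_of_def)
    with assms step show ?case by (auto simp: avoiding_def intro: comp_of_step)
  qed
  then show ?thesis by (auto simp: comp_of_def)
qed

lemma comp_of_antimono: "Y \<subseteq> X \<Longrightarrow> v \<notin> X \<Longrightarrow> comp_of E X v \<subseteq> comp_of E Y v"
  using comp_of_disjoint[of v X] by (intro comp_of_mono) auto

text \<open>If \<open>x\<close> had no neighbour in the component of \<open>t\<close>, returning
  \<open>x\<close> to the graph would not enlarge that component, and \<open>S - {x}\<close> would
  still separate.\<close>

lemma is_minsep_nbr_t:
  assumes S: "is_minsep S" and x: "x \<in> S"
  shows "\<exists>y \<in> comp_of E S t. (y, x) \<in> E"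
proof (rule ccontr)
  assume no: "\<not> ?thesis"
  have "comp_of E (S - {x}) t \<subseteq> comp_of E S t"
  proof (rule comp_of_least)
    fix u w assume u: "u \<in> comp_of E S t" and uw: "(u, w) \<in> E" "w \<notin> S - {x}"
    have "t \<notin> S" using S by (auto simp: is_minsep_def is_sep_def)
    with u have "u \<notin> S" using comp_of_disjoint by blast
    moreover have "w \<noteq> x" using no u uw by blast
    ultimately show "w \<in> comp_of E S t" using u uw by (auto intro: comp_of_step)
  qed simp
  with S have "is_sep (S - {x})" by (auto simp: is_minsep_def is_sep_def)
  moreover have "S - {x} \<subset> S" using x by auto
  ultimately show False using S by (auto simp: is_minsep_def)
qed

text \<open>Exchanging the terminals turns each fact about the side of \<open>t\<close> into one
  about the side of \<open>s\<close>.\<close>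

lemma st_graph_swap: "st_graph V E t s"
  by unfold_locales (use finite_V E_subset sym_E s_V t_V s_neq_t not_adj E_sym in auto)

lemma is_sep_swap: "st_graph.is_sep V E t s S \<longleftrightarrow> is_sep S"
  unfolding st_graph.is_sep_def[OF st_graph_swap] is_sep_def using comp_of_sym by auto

lemma is_minsep_nbr_s:
  assumes "is_minsep S" and "x \<in> S"
  shows "\<exists>y \<in> comp_of E S s. (y, x) \<in> E"
  using assms st_graph.is_minsep_nbr_t[OF st_graph_swap, of S x]
  unfolding st_graph.is_minsep_def[OF st_graph_swap] is_minsep_def is_sep_swap by blast

text \<open>A vertex dropped from \<open>S\<close> borders both components and so joins them. With
  \<open>is_minsep_nbr_t\<close> and \<open>is_minsep_nbr_s\<close> this characterises minimal
  separators by full components.\<close>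

lemma is_minsepI:
  assumes S: "is_sep S"
    and nbr_t: "\<And>x. x \<in> S \<Longrightarrow> \<exists>y \<in> comp_of E S t. (y, x) \<in> E"
    and nbr_s: "\<And>x. x \<in> S \<Longrightarrow> \<exists>y \<in> comp_of E S s. (y, x) \<in> E"
  shows "is_minsep S"
  unfolding is_minsep_def
proof (intro conjI allI impI notI S)
  fix S' assume S': "S' \<subset> S" "is_sep S'"
  then obtain x where x: "x \<in> S" "x \<notin> S'" by blast
  have st: "s \<notin> S" "t \<notin> S" using S by (auto simp: is_sep_def)
  obtain y z where y: "y \<in> comp_of E S t" "(y, x) \<in> E" and z: "z \<in> comp_of E S s" "(z, x) \<in> E"
    using nbr_t nbr_s x by blast
  have "y \<notin> S" "z \<notin> S" using comp_of_disjoint st y z by blast+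
  have y': "y \<in> comp_of E S' t" using comp_of_antimono[of S' S t] S' st y by blast
  have z': "z \<in> comp_of E S' s" using comp_of_antimono[of S' S s] S' st z by blast
  have "x \<in> comp_of E S' t" using y' y x \<open>y \<notin> S\<close> S' by (blast intro: comp_of_step)
  then have "z \<in> comp_of E S' t" using z x \<open>z \<notin> S\<close> S' E_sym by (blast intro: comp_of_step)
  then have "s \<in> comp_of E S' t" using z' comp_of_trans comp_of_sym by blast
  then show False using S' by (auto simp: is_sep_def)
qed

lemma is_sep_superset: "is_sep S \<Longrightarrow> S \<subseteq> S' \<Longrightarrow> S' \<subseteq> V - {s, t} \<Longrightarrow> is_sep S'"
  unfolding is_sep_def using comp_of_antimono[of S S' t] by blast

lemma is_sep_finite: "is_sep S \<Longrightarrow> finite S"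
  unfolding is_sep_def using finite_V finite_subset by blast

lemma ex_minsep_subset:
  assumes "is_sep S" obtains M where "is_minsep M" "M \<subseteq> S"
proof -
  have "finite {M. M \<subseteq> S \<and> is_sep M}" using is_sep_finite[OF assms] by simp
  moreover have "S \<in> {M. M \<subseteq> S \<and> is_sep M}" using assms by simp
  ultimately obtain M where M: "M \<in> {M. M \<subseteq> S \<and> is_sep M}"
    "\<forall>M' \<in> {M. M \<subseteq> S \<and> is_sep M}. M' \<subseteq> M \<longrightarrow> M = M'"
    using finite_has_minimal[of "{M. M \<subseteq> S \<and> is_sep M}"] by blast
  then have "is_minsep M" unfolding is_minsep_def by blast
  then show thesis using that M by blast
qed

lemma minsep_eq: "is_minsep S \<Longrightarrow> is_minsep T \<Longrightarrow> S \<subseteq> T \<Longrightarrow> S = T"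
  unfolding is_minsep_def by blast

section \<open>Cores, and stepping from one minimal separator to the next\<close>

lemma core_subset:
  assumes "t \<notin> X" shows "core E t X \<subseteq> X"
  using comp_of_disjoint[OF assms] unfolding core_def nbrs_def by (blast intro: comp_of_step)

lemma comp_of_core:
  assumes "t \<notin> X" shows "comp_of E (core E t X) t = comp_of E X t"
proof
  show "comp_of E (core E t X) t \<subseteq> comp_of E X t"
    by (rule comp_of_least) (auto simp: core_def nbrs_def)
  show "comp_of E X t \<subseteq> comp_of E (core E t X) t"
    by (rule comp_of_antimono[OF core_subset]) (use assms in auto)
qed

lemma core_nbr_t:
  assumes "t \<notin> X" "x \<in> core E t X" shows "\<exists>y \<in> comp_of E (core E t X) t. (y, x) \<in> E"
  unfolding comp_of_core[OF assms(1)] using assms(2) by (auto simp: core_def nbrs_def)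

lemma is_sep_core:
  assumes "t \<notin> X" "s \<notin> X" "s \<notin> comp_of E X t" shows "is_sep (core E t X)"
  unfolding is_sep_def comp_of_core[OF assms(1)]
  using assms core_subset[OF assms(1)] E_subset by (auto simp: core_def nbrs_def)

definition first_sep :: "'a set" where
  "first_sep = core E t (nbrs E {s})"

definition next_sep :: "'a set \<Rightarrow> 'a \<Rightarrow> 'a set" where
  "next_sep S x = core E t (nbrs E {x} \<union> S)"

lemma t_notin_nbrs_s: "t \<notin> nbrs E {s}"
  using not_adj by (auto simp: nbrs_def)

lemma s_notin_comp_nbrs: "s \<notin> comp_of E (nbrs E {s}) t"
proof -
  have "comp_of E (nbrs E {s}) t \<subseteq> - {s}"
    by (rule comp_of_least) (use s_neq_t E_sym in \<open>auto simp: nbrs_def\<close>)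
  then show ?thesis by blast
qed

text \<open>The core lies in the neighbourhood of \<open>s\<close>, so each of its vertices sees
  \<open>s\<close>; seeing the side of \<open>t\<close> is automatic for a core.\<close>

lemma first_sep_minsep: "is_minsep first_sep"
  unfolding first_sep_def
proof (rule is_minsepI)
  show "is_sep (core E t (nbrs E {s}))"
    by (rule is_sep_core[OF t_notin_nbrs_s _ s_notin_comp_nbrs]) (auto simp: nbrs_def)
  fix x assume x: "x \<in> core E t (nbrs E {s})"
  show "\<exists>y \<in> comp_of E (core E t (nbrs E {s})) t. (y, x) \<in> E"
    by (rule core_nbr_t[OF t_notin_nbrs_s x])
  have "x \<in> nbrs E {s}" using core_subset[OF t_notin_nbrs_s] x by blast
  then show "\<exists>y \<in> comp_of E (core E t (nbrs E {s})) s. (y, x) \<in> E"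
    by (auto simp: nbrs_def intro!: bexI[of _ s])
qed

text \<open>The inclusion is strict: minimality gives \<open>x\<close> a neighbour in the old
  component of \<open>t\<close>, and this neighbour is now among the deleted vertices.\<close>

lemma next_sep_comp:
  assumes S: "is_minsep S" and x: "x \<in> S" "(x, t) \<notin> E"
  shows "comp_of E (next_sep S x) t \<subset> comp_of E S t" "t \<notin> nbrs E {x} \<union> S"
proof -
  show t: "t \<notin> nbrs E {x} \<union> S" using S x by (auto simp: nbrs_def is_minsep_def is_sep_def)
  have "comp_of E (nbrs E {x} \<union> S) t \<subseteq> comp_of E S t"
    by (rule comp_of_antimono) (use t in auto)
  moreover obtain y where y: "y \<in> comp_of E S t" "(y, x) \<in> E" using is_minsep_nbr_t[OF S x(1)] by
      blast
  have "y \<notin> comp_of E (nbrs E {x} \<union> S) t"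
  proof -
    have "y \<notin> S" using y t comp_of_disjoint[of t S] by blast
    then have "y \<in> nbrs E {x}" using y x E_sym by (auto simp: nbrs_def)
    then show ?thesis using comp_of_disjoint[OF t] by blast
  qed
  ultimately show "comp_of E (next_sep S x) t \<subset> comp_of E S t"
    unfolding next_sep_def comp_of_core[OF t] using y by blast
qed

text \<open>The new separator leaves the old component of \<open>s\<close> intact and omits
  \<open>x\<close>, so \<open>x\<close> joins the side of \<open>s\<close>. Each of its vertices is
  a neighbour of \<open>x\<close> or belongs to \<open>S\<close>, and in either case it sees that
  side; the side of \<open>t\<close> comes from the core.\<close>

lemma next_sep_minsep:
  assumes S: "is_minsep S" and x: "x \<in> S" "(x, t) \<notin> E"
  shows "is_minsep (next_sep S x)"
proof -
  let ?X = "nbrs E {x} \<union> S"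
  note t = next_sep_comp(2)[OF assms]
  have s: "s \<notin> comp_of E S t" "s \<notin> S" "t \<notin> S" using S by (auto simp: is_minsep_def is_sep_def)
  have comp: "comp_of E (core E t ?X) t \<subseteq> comp_of E S t"
    using next_sep_comp(1)[OF assms] by (auto simp: next_sep_def)
  have Xcomp: "comp_of E ?X t \<subseteq> comp_of E S t"
    using comp unfolding comp_of_core[OF t] .
  \<comment> \<open>A vertex of the new separator borders the shrunken component of
    \<open>t\<close>, so it lies in the old component or on its boundary, never on the side of
    \<open>s\<close>.\<close>
  have core_sub: "w \<in> S \<or> w \<in> comp_of E S t" if "w \<in> core E t ?X" for w
  proof (rule disjCI)
    assume "w \<notin> comp_of E S t"
    obtain u where u: "u \<in> comp_of E ?X t" "(u, w) \<in> E"
      using \<open>w \<in> core E t ?X\<close> by (auto simp: core_def nbrs_def)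
    then have "u \<in> comp_of E S t" "u \<notin> S"
      using Xcomp comp_of_disjoint[of t S] s by blast+
    then show "w \<in> S" using u \<open>w \<notin> comp_of E S t\<close> by (blast intro: comp_of_step)
  qed
  \<comment> \<open>Everything adjacent to \<open>x\<close> is in the deleted set, so
    \<open>x\<close> cannot border the component of \<open>t\<close>.\<close>
  have x_core: "x \<notin> core E t ?X"
  proof
    assume "x \<in> core E t ?X"
    then obtain u where u: "u \<in> comp_of E ?X t" "(u, x) \<in> E" by (auto simp: core_def nbrs_def)
    then have "u \<in> ?X" using E_sym x by (auto simp: nbrs_def)
    then show False using u comp_of_disjoint[OF t] by blast
  qed
  have disj: "comp_of E S s \<inter> core E t ?X = {}"
  proof -
    have "comp_of E S s \<inter> S = {}" using comp_of_disjoint s by blast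
    moreover have "comp_of E S s \<inter> comp_of E S t = {}"
      using s comp_of_sym comp_of_trans by blast
    ultimately show ?thesis using core_sub by blast
  qed
  have sub_s: "comp_of E S s \<subseteq> comp_of E (core E t ?X) s" by (rule comp_of_mono[OF disj])
  obtain y where y: "y \<in> comp_of E S s" "(y, x) \<in> E" using is_minsep_nbr_s[OF S x(1)] by blast
  have x_s: "x \<in> comp_of E (core E t ?X) s"
    using y sub_s x_core disj by (blast intro: comp_of_step)
  have sX: "s \<notin> core E t ?X" using disj comp_of_self by blast
  show ?thesis unfolding next_sep_def
  proof (rule is_minsepI)
    show "is_sep (core E t ?X)"
      unfolding is_sep_def
      using sX s comp core_subset[OF t] t E_subset by (auto simp: core_def nbrs_def)
    fix w assume w: "w \<in> core E t ?X"
    show "\<exists>y \<in> comp_of E (core E t ?X) t. (y, w) \<in> E" by (rule core_nbr_t[OF t w])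
    have "w \<in> ?X" using w core_subset[OF t] by blast
    then show "\<exists>y \<in> comp_of E (core E t ?X) s. (y, w) \<in> E"
    proof
      assume "w \<in> nbrs E {x}" then show ?thesis using x_s by (auto simp: nbrs_def)
    next
      assume "w \<in> S" then show ?thesis using is_minsep_nbr_s[OF S] sub_s by blast
    qed
  qed
qed

text \<open>A component of \<open>t\<close> meeting the neighbourhood of \<open>s\<close> would
  contain \<open>s\<close>. So \<open>first_sep\<close> has the largest component of
  \<open>t\<close>, and every target lies ahead of it.\<close>

lemma first_sep_comp:
  assumes "is_minsep T" shows "comp_of E T t \<subseteq> comp_of E first_sep t"
proof -
  have "s \<notin> T" "t \<notin> T" "s \<notin> comp_of E T t" using assms by (auto simp: is_minsep_def is_sep_def)
  then have "comp_of E T t \<inter> nbrs E {s} = {}"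
    using comp_of_disjoint[of t T] E_sym by (auto simp: nbrs_def intro: comp_of_step)
  then show ?thesis unfolding first_sep_def comp_of_core[OF t_notin_nbrs_s] by (rule comp_of_mono)
qed

text \<open>
  As long as \<open>S \<noteq> T\<close>, a vertex \<open>x \<in> S - T\<close> is not adjacent to the
  component of \<open>t\<close> in \<open>G - T\<close>, so stepping over \<open>x\<close> keeps that component intact.
\<close>

lemma next_sep_towards:
  assumes S: "is_minsep S" and T: "is_minsep T" and sub: "comp_of E T t \<subseteq> comp_of E S t" and "S \<noteq> T"
  obtains x where "x \<in> S" "(x, t) \<notin> E" "comp_of E T t \<subseteq> comp_of E (next_sep S x) t"
proof -
  obtain x where x: "x \<in> S" "x \<notin> T" using minsep_eq[OF S T] \<open>S \<noteq> T\<close> by blast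
  have st: "t \<notin> S" "t \<notin> T" using S T by (auto simp: is_minsep_def is_sep_def)
  have xT: "x \<notin> comp_of E T t" using sub x comp_of_disjoint[of t S] st by blast
  have no: "(u, x) \<notin> E" if "u \<in> comp_of E T t" for u
    using that xT x(2) comp_of_disjoint[of t T] st by (blast intro: comp_of_step)
  have xt: "(x, t) \<notin> E" using no[of t] E_sym by auto
  have "comp_of E T t \<inter> (nbrs E {x} \<union> S) = {}"
    using no E_sym sub comp_of_disjoint[of t S] st by (auto simp: nbrs_def)
  then have "comp_of E T t \<subseteq> comp_of E (nbrs E {x} \<union> S) t" by (rule comp_of_mono)
  then show thesis
    using that[OF x(1) xt] comp_of_core[OF next_sep_comp(2)[OF S x(1) xt]]
    by (simp add: next_sep_def)
qed

definition next_seps :: "'a set set \<Rightarrow> 'a set set" where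
  "next_seps L = L \<union> {next_sep S x | S x. S \<in> L \<and> x \<in> S \<and> (x, t) \<notin> E}"

lemma next_seps_iterate_minsep: "(next_seps ^^ n) {first_sep} \<subseteq> {S. is_minsep S}"
  by (induction n) (auto simp: first_sep_minsep next_seps_def next_sep_minsep)

lemma next_seps_iterate:
  "(next_seps ^^ card V) {first_sep} = {S. is_minsep S}"
proof
  show "(next_seps ^^ card V) {first_sep} \<subseteq> {S. is_minsep S}"
    by (rule next_seps_iterate_minsep)
  have "T \<in> (next_seps ^^ card V) {first_sep}" if T: "is_minsep T" for T
  proof -
    \<comment> \<open>The component of \<open>t\<close> encloses that of the target and, until
      \<open>T\<close> is found, loses a vertex per round. After \<open>card V\<close> rounds it
      would be empty, yet it contains \<open>t\<close>.\<close>
    have *: "\<exists>S \<in> (next_seps ^^ n) {first_sep}. comp_of E T t \<subseteq> comp_of E S t \<and>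
        (S = T \<or> card (comp_of E S t) + n \<le> card V)" for n
    proof (induction n)
      case 0
      have "card (comp_of E first_sep t) \<le> card V"
        by (rule card_mono[OF finite_V comp_of_subset[OF t_V]])
      then show ?case using first_sep_comp[OF T] by auto
    next
      case (Suc n)
      then obtain S where S: "S \<in> (next_seps ^^ n) {first_sep}" "comp_of E T t \<subseteq> comp_of E S t"
        "S = T \<or> card (comp_of E S t) + n \<le> card V" by blast
      show ?case
      proof (cases "S = T")
        case True
        then have "T \<in> (next_seps ^^ Suc n) {first_sep}"
          using S(1) by (simp add: next_seps_def[of "(next_seps ^^ n) _"])
        then show ?thesis by blast
      next
        case False
        have mS: "is_minsep S" using S(1) next_seps_iterate_minsep by blast
        obtain x where x: "x \<in> S" "(x, t) \<notin> E" "comp_of E T t \<subseteq> comp_of E (next_sep S x) t"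
          using next_sep_towards[OF mS T S(2) False] by blast
        have "card (comp_of E (next_sep S x) t) < card (comp_of E S t)"
          by (rule psubset_card_mono[OF _ next_sep_comp(1)[OF mS x(1,2)]])
            (rule finite_subset[OF comp_of_subset[OF t_V] finite_V])
        moreover have "next_sep S x \<in> (next_seps ^^ Suc n) {first_sep}"
          using S(1) x by (auto simp: next_seps_def[of "(next_seps ^^ n) _"])
        ultimately show ?thesis using S False x
          by (intro bexI[of _ "next_sep S x"]) auto
      qed
    qed
    obtain S where S: "S \<in> (next_seps ^^ card V) {first_sep}"
      "S = T \<or> card (comp_of E S t) + card V \<le> card V" using *[of "card V"] by blast
    have "card (comp_of E S t) > 0"
      using comp_of_self finite_subset[OF comp_of_subset[OF t_V] finite_V] card_gt_0_iff by blast
    then show ?thesis using S by auto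
  qed
  then show "{S. is_minsep S} \<subseteq> (next_seps ^^ card V) {first_sep}" by blast
qed

end


section \<open>Reconfiguration through minimal separators\<close>

context st_graph
begin

definition sep_step :: "('a set \<Rightarrow> 'a set \<Rightarrow> bool) \<Rightarrow> ('a set \<times> 'a set) set" where
  "sep_step adj = {(X, Y). is_sep X \<and> is_sep Y \<and> adj X Y}"

definition nodes :: "nat \<Rightarrow> 'a set \<Rightarrow> 'a set \<Rightarrow> 'a set set" where
  "nodes k A B = {A, B} \<union> {M. is_minsep M \<and> card M \<le> k}"

text \<open>The bound \<open>k\<close> on minimal separators and the bound \<open>m\<close> on
  unions are kept apart: TAR uses \<open>m = k\<close>, TJ uses \<open>m = k + 1\<close>.\<close>

definition links :: "nat \<Rightarrow> nat \<Rightarrow> 'a set \<Rightarrow> 'a set \<Rightarrow> ('a set \<times> 'a set) set" where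
  "links k m A B = {(X, Y). X \<in> nodes k A B \<and> Y \<in> nodes k A B \<and> card (X \<union> Y) \<le> m}"

lemma reconfiguration_imp_links:
  assumes A: "is_sep A" "card A \<le> k" and B: "is_sep B" "card B \<le> k" and km: "k \<le> m"
    and adj: "\<And>X Y. is_sep X \<Longrightarrow> is_sep Y \<Longrightarrow> card X \<le> k \<Longrightarrow> adj X Y \<Longrightarrow> card Y \<le> k \<and> card (X \<union> Y) \<le> m"
    and path: "(A, B) \<in> (sep_step adj)\<^sup>*"
  shows "(A, B) \<in> (links k m A B)\<^sup>*"
proof -
  have node: "M \<in> nodes k A B" if "is_minsep M" "M \<subseteq> S" "is_sep S" "card S \<le> k" for M S
    using that card_mono[OF is_sep_finite[of S] \<open>M \<subseteq> S\<close>] by (auto simp: nodes_def)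
  \<comment> \<open>The induction follows all minimal separators inside the current set at once. A
    step from \<open>S\<close> to \<open>S'\<close> links each \<open>M\<close> inside
    \<open>S\<close> to each \<open>M'\<close> inside \<open>S'\<close>, because their union lies in
    \<open>S \<union> S'\<close>.\<close>
  have "is_sep S \<and> card S \<le> k \<and> (\<forall>M. is_minsep M \<longrightarrow> M \<subseteq> S \<longrightarrow> (A, M) \<in> (links k m A B)\<^sup>*)"
    if "(A, S) \<in> (sep_step adj)\<^sup>*" for S
    using that
  proof (induction rule: rtrancl_induct)
    case base
    have "(A, M) \<in> links k m A B" if "is_minsep M" "M \<subseteq> A" for M
      using that A km node[OF that A] by (auto simp: links_def nodes_def Un_absorb2)
    then show ?case using A by blast
  next
    case (step S S')
    have S: "is_sep S" "is_sep S'" "card S \<le> k" "card S' \<le> k" "card (S \<union> S') \<le> m"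
      using step adj[of S S'] by (auto simp: sep_step_def)
    obtain M where M: "is_minsep M" "M \<subseteq> S" using ex_minsep_subset[OF S(1)] by blast
    have "(A, M') \<in> (links k m A B)\<^sup>*" if M': "is_minsep M'" "M' \<subseteq> S'" for M'
    proof -
      have "card (M \<union> M') \<le> card (S \<union> S')"
        using M M' S is_sep_finite by (intro card_mono) auto
      then have "(M, M') \<in> links k m A B"
        using S M M' node by (auto simp: links_def)
      then show ?thesis using step.IH M by (meson rtrancl.rtrancl_into_rtrancl)
    qed
    then show ?case using S by blast
  qed
  moreover obtain M where M: "is_minsep M" "M \<subseteq> B" using ex_minsep_subset[OF B(1)] by blast
  ultimately have "(A, M) \<in> (links k m A B)\<^sup>*" using path by blast
  moreover have "(M, B) \<in> links k m A B"
    using M B km node[OF M B] by (auto simp: links_def nodes_def Un_absorb1)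
  ultimately show ?thesis by (rule rtrancl_into_rtrancl)
qed

lemma nodes_is_sep: "is_sep A \<Longrightarrow> is_sep B \<Longrightarrow> X \<in> nodes k A B \<Longrightarrow> is_sep X"
  by (auto simp: nodes_def is_minsep_def)

lemma is_sep_subset: "is_sep S \<Longrightarrow> S \<subseteq> V - {s, t}"
  by (simp add: is_sep_def)

lemma is_sep_Un: "is_sep X \<Longrightarrow> is_sep Y \<Longrightarrow> is_sep (X \<union> Y)"
  by (rule is_sep_superset[of X]) (auto simp: is_sep_def)

text \<open>Vertices are added one by one; every intermediate set contains \<open>X\<close>, hence
  separates, and is no larger than \<open>Z\<close>.\<close>

lemma sep_step_tar_superset:
  assumes X: "is_sep X" and Z: "is_sep Z" "X \<subseteq> Z" "card Z \<le> k"
  shows "(X, Z) \<in> (sep_step (tar_adjacent k))\<^sup>*"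
proof -
  have fin: "finite Z" using is_sep_finite Z by blast
  have "(X, X \<union> W) \<in> (sep_step (tar_adjacent k))\<^sup>*" if "finite W" "W \<subseteq> Z - X" for W
    using that
  proof (induction W rule: finite_induct)
    case (insert w W)
    have "sym_diff (X \<union> W) (X \<union> insert w W) = {w}" using insert by auto
    moreover have "card (X \<union> W) \<le> card Z" "card (X \<union> insert w W) \<le> card Z"
      using insert Z fin by (auto intro!: card_mono)
    moreover have "is_sep (X \<union> W)" "is_sep (X \<union> insert w W)"
      using insert Z by (auto intro!: is_sep_superset[OF X] dest: is_sep_subset)
    ultimately have "(X \<union> W, X \<union> insert w W) \<in> sep_step (tar_adjacent k)"
      using Z by (auto simp: sep_step_def tar_adjacent_def)
    then show ?case using insert by (auto intro: rtrancl_into_rtrancl)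
  qed simp
  from this[of "Z - X"] show ?thesis using fin Z by (simp add: Un_absorb1)
qed

lemma sym_sep_step_tar: "sym (sep_step (tar_adjacent k))"
  by (auto simp: sym_def sep_step_def tar_adjacent_def Un_commute max.commute)

theorem tar_iff_links:
  assumes A: "is_sep A" "card A \<le> k" and B: "is_sep B" "card B \<le> k"
  shows "(A, B) \<in> (sep_step (tar_adjacent k))\<^sup>* \<longleftrightarrow> (A, B) \<in> (links k k A B)\<^sup>*"
proof
  assume "(A, B) \<in> (sep_step (tar_adjacent k))\<^sup>*"
  then show "(A, B) \<in> (links k k A B)\<^sup>*"
  proof (rule reconfiguration_imp_links[OF A B order_refl, rotated])
    fix X Y assume XY: "is_sep X" "is_sep Y" "card X \<le> k" "tar_adjacent k X Y"
    then have fin: "finite X" "finite Y" using is_sep_finite by auto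
    obtain z where z: "sym_diff X Y = {z}"
      using XY(4) by (auto simp: tar_adjacent_def card_1_singleton_iff)
    \<comment> \<open>A symmetric difference with one element forces inclusion, so the union is the
      larger of the two sets.\<close>
    have "X \<subseteq> Y \<or> Y \<subseteq> X"
    proof (rule ccontr)
      assume "\<not> (X \<subseteq> Y \<or> Y \<subseteq> X)"
      then obtain a b where ab: "a \<in> X" "a \<notin> Y" "b \<in> Y" "b \<notin> X" by blast
      then have "a \<in> sym_diff X Y" "b \<in> sym_diff X Y" by simp_all
      then have "a = b" unfolding z by simp
      then show False using ab by simp
    qed
    then show "card Y \<le> k \<and> card (X \<union> Y) \<le> k"
      using XY(4) by (auto simp: tar_adjacent_def Un_absorb1 Un_absorb2)
  qed
next
  assume "(A, B) \<in> (links k k A B)\<^sup>*"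
  then show "(A, B) \<in> (sep_step (tar_adjacent k))\<^sup>*"
  proof (induction rule: rtrancl_induct)
    case (step X Y)
    have XY: "is_sep X" "is_sep Y" "card (X \<union> Y) \<le> k"
      using step nodes_is_sep[OF A(1) B(1)] by (auto simp: links_def)
    \<comment> \<open>A link is realised by growing both ends to their union and reversing the
      second sequence.\<close>
    have "(X, X \<union> Y) \<in> (sep_step (tar_adjacent k))\<^sup>*" "(Y, X \<union> Y) \<in> (sep_step (tar_adjacent k))\<^sup>*"
      using XY is_sep_Un by (auto intro!: sep_step_tar_superset)
    then have "(X, Y) \<in> (sep_step (tar_adjacent k))\<^sup>*"
      using sym_rtrancl[OF sym_sep_step_tar] by (meson rtrancl_trans symD)
    then show ?case using step by (meson rtrancl_trans)
  qed simp
qed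

text \<open>While \<open>P\<close> and \<open>Q\<close> differ, a vertex of \<open>P - Q\<close> is
  exchanged for one of \<open>Q - P\<close>. Both lie outside \<open>X\<close>, so the new set still
  contains \<open>X\<close> and separates.\<close>

lemma sep_step_tj_common_subset:
  assumes X: "is_sep X" and P: "X \<subseteq> P" "P \<subseteq> V - {s, t}" and Q: "X \<subseteq> Q" "Q \<subseteq> V - {s, t}"
    and "card P = card Q"
  shows "(P, Q) \<in> (sep_step tj_adjacent)\<^sup>*"
  using assms(2-)
proof (induction "card (P - Q)" arbitrary: P)
  case 0
  have fin: "finite P" "finite Q" using 0 finite_V by (auto intro: finite_subset)
  then have "P \<subseteq> Q" using 0 by simp
  then have "P = Q" using 0 fin by (simp add: card_subset_eq)
  then show ?case by simp
next
  case (Suc n)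
  have fin: "finite P" "finite Q" using Suc.prems finite_V by (auto intro: finite_subset)
  obtain p where p: "p \<in> P" "p \<notin> Q" using Suc.hyps(2) by (metis Diff_eq_empty_iff card.empty
      nat.simps(3) subsetI)
  have "\<not> Q \<subseteq> P" using p Suc.prems fin by (metis card_subset_eq)
  then obtain q where q: "q \<in> Q" "q \<notin> P" by blast
  define P' where "P' = insert q (P - {p})"
  have card: "card P' = card P" using p q fin by (metis P'_def Diff_iff card.insert card.remove
      finite_Diff)
  have sub: "X \<subseteq> P'" "P' \<subseteq> V - {s, t}" using p q Suc.prems by (auto simp: P'_def)
  have "P - P' = {p}" "P' - P = {q}" using p q by (auto simp: P'_def)
  then have "(P, P') \<in> sep_step tj_adjacent"
    using card sub Suc.prems is_sep_superset[OF X] by (auto simp: sep_step_def tj_adjacent_def)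
  moreover have "(P', Q) \<in> (sep_step tj_adjacent)\<^sup>*"
  proof (rule Suc.hyps(1))
    have "P' - Q = (P - Q) - {p}" using p q by (auto simp: P'_def)
    then show "n = card (P' - Q)" using Suc.hyps(2) p fin by simp
  qed (use sub card Suc.prems in auto)
  ultimately show ?case by (rule converse_rtrancl_into_rtrancl)
qed

lemma superset_of_card:
  assumes "finite U" "X \<subseteq> U" "card X \<le> k" "k \<le> card U"
  obtains W where "X \<subseteq> W" "W \<subseteq> U" "card W = k"
  using exists_subset_between[of X k U] assms by blast

text \<open>A node may have fewer than \<open>k\<close> vertices, whereas TJ moves sets of exactly
  \<open>k\<close>. So a node stands for all its supersets of size \<open>k\<close> avoiding
  \<open>s\<close> and \<open>t\<close>, any two of which are connected.\<close>

theorem tj_iff_links: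
  assumes A: "is_sep A" "card A = k" and B: "is_sep B" "card B = k"
  shows "(A, B) \<in> (sep_step tj_adjacent)\<^sup>* \<longleftrightarrow> (A, B) \<in> (links k (k + 1) A B)\<^sup>*"
proof
  assume "(A, B) \<in> (sep_step tj_adjacent)\<^sup>*"
  then show "(A, B) \<in> (links k (k + 1) A B)\<^sup>*"
  proof (rule reconfiguration_imp_links[rotated -1])
    fix X Y assume XY: "is_sep X" "is_sep Y" "card X \<le> k" "tj_adjacent X Y"
    then have fin: "finite X" "finite Y" using is_sep_finite by auto
    have "X \<union> Y = X \<union> (Y - X)" by blast
    then have "card (X \<union> Y) \<le> card X + card (Y - X)" by (metis card_Un_le)
    then show "card Y \<le> k \<and> card (X \<union> Y) \<le> k + 1"
      using XY by (auto simp: tj_adjacent_def)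
  qed (use A B in auto)
next
  let ?U = "V - {s, t}"
  let ?R = "(sep_step tj_adjacent)\<^sup>*"
  have finU: "finite ?U" using finite_V by simp
  have AU: "A \<subseteq> ?U" "k \<le> card ?U" using A card_mono[OF finU, of A] by (auto simp: is_sep_def)
  have node: "is_sep X" "X \<subseteq> ?U" "card X \<le> k" "finite X" if "X \<in> nodes k A B" for X
  proof -
    show X: "is_sep X" using nodes_is_sep[OF A(1) B(1) that] .
    show "X \<subseteq> ?U" "finite X" using is_sep_subset[OF X] is_sep_finite[OF X] .
    show "card X \<le> k" using that A(2) B(2) by (auto simp: nodes_def)
  qed
  assume "(A, B) \<in> (links k (k + 1) A B)\<^sup>*"
  \<comment> \<open>The claim is strengthened to all such supersets of the current node; at the
    start, \<open>A\<close> is its own only one.\<close>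
  then have "\<forall>Q. B \<subseteq> Q \<longrightarrow> Q \<subseteq> ?U \<longrightarrow> card Q = k \<longrightarrow> (A, Q) \<in> ?R"
  proof (induction rule: rtrancl_induct)
    case base
    have "Q = A" if "A \<subseteq> Q" "Q \<subseteq> ?U" "card Q = k" for Q
      using that A finU by (metis card_subset_eq finite_subset)
    then show ?case by blast
  next
    case (step X Y)
    have X: "X \<in> nodes k A B" and Y: "Y \<in> nodes k A B" and XY: "card (X \<union> Y) \<le> k + 1"
      using step by (auto simp: links_def)
    note nX = node[OF X] and nY = node[OF Y]
    \<comment> \<open>Across a link these supersets can be chosen equal or one jump apart: a small
      union is padded to \<open>k\<close> vertices, and a union of size \<open>k + 1\<close> omits
      one vertex of \<open>Y - X\<close> for \<open>P\<close> and one of \<open>X - Y\<close> for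
      \<open>Q\<close>.\<close>
    obtain P Q where P: "X \<subseteq> P" "P \<subseteq> ?U" "card P = k" and Q: "Y \<subseteq> Q" "Q \<subseteq> ?U" "card Q = k"
      and PQ: "(P, Q) \<in> ?R"
    proof (cases "card (X \<union> Y) \<le> k")
      case True
      obtain W where "X \<union> Y \<subseteq> W" "W \<subseteq> ?U" "card W = k"
        using superset_of_card[OF finU _ True AU(2)] nX nY by blast
      then show thesis using that[of W W] by blast
    next
      case False
      let ?W = "X \<union> Y"
      have W: "card ?W = k + 1" using False XY by simp
      have fin: "finite ?W" using nX nY by simp
      have "?W \<noteq> X" "?W \<noteq> Y" using W nX(3) nY(3) by force+
      then obtain x y where x: "x \<in> X" "x \<notin> Y" and y: "y \<in> Y" "y \<notin> X" by blast
      have cards: "card (?W - {y}) = k" "card (?W - {x}) = k" using x y W fin by auto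
      have diff: "(?W - {y}) - (?W - {x}) = {x}" "(?W - {x}) - (?W - {y}) = {y}" using x y by auto
      have "is_sep (?W - {y})" by (rule is_sep_superset[OF nX(1)]) (use y nX(2) nY(2) in auto)
      moreover have "is_sep (?W - {x})" by (rule is_sep_superset[OF nY(1)]) (use x nX(2) nY(2) in
          auto)
      ultimately have "(?W - {y}, ?W - {x}) \<in> sep_step tj_adjacent"
        using cards diff by (simp add: sep_step_def tj_adjacent_def)
      then show thesis using that[of "?W - {y}" "?W - {x}"] x y nX nY cards by blast
    qed
    show ?case
    proof (intro allI impI)
      fix Q' assume Q': "Y \<subseteq> Q'" "Q' \<subseteq> ?U" "card Q' = k"
      have "(A, P) \<in> ?R" using step.IH P by blast
      moreover have "(Q, Q') \<in> ?R"
        using sep_step_tj_common_subset[OF nY(1) Q(1,2) Q'(1,2)] Q Q' by simp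
      ultimately show "(A, Q') \<in> ?R" using PQ by (meson rtrancl_trans)
    qed
  qed
  then show "(A, B) \<in> ?R" using B by (auto simp: is_sep_def)
qed

end

section \<open>From sequences and strong components to the relational setting\<close>

text \<open>\<open>P a\<close> is a separate conjunct because the closure relates \<open>a\<close>
  to itself even when \<open>P a\<close> fails.\<close>

lemma successively_iff_rtrancl:
  "(\<exists>xs. xs \<noteq> [] \<and> hd xs = a \<and> last xs = b \<and> (\<forall>x \<in> set xs. P x) \<and> successively r xs) \<longleftrightarrow>
   P a \<and> (a, b) \<in> {(x, y). P x \<and> P y \<and> r x y}\<^sup>*"
proof
  have "P (hd xs) \<and> (hd xs, last xs) \<in> {(x, y). P x \<and> P y \<and> r x y}\<^sup>*"
    if "xs \<noteq> []" "\<forall>x \<in> set xs. P x" "successively r xs" for xs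
    using that
  proof (induction xs rule: list_nonempty_induct)
    case (cons x xs)
    then show ?case by (auto simp: successively_Cons intro!: converse_rtrancl_into_rtrancl[of x
        "hd xs"])
  qed simp
  then show "\<exists>xs. xs \<noteq> [] \<and> hd xs = a \<and> last xs = b \<and> (\<forall>x \<in> set xs. P x) \<and> successively r xs \<Longrightarrow>
    P a \<and> (a, b) \<in> {(x, y). P x \<and> P y \<and> r x y}\<^sup>*" by blast
next
  assume *: "P a \<and> (a, b) \<in> {(x, y). P x \<and> P y \<and> r x y}\<^sup>*"
  then have "(a, b) \<in> {(x, y). P x \<and> P y \<and> r x y}\<^sup>*" by blast
  then show "\<exists>xs. xs \<noteq> [] \<and> hd xs = a \<and> last xs = b \<and> (\<forall>x \<in> set xs. P x) \<and> successively r xs"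
  proof (induction rule: rtrancl_induct)
    case base
    then show ?case using * by (intro exI[of _ "[a]"]) auto
  next
    case (step y z)
    then obtain xs where "xs \<noteq> []" "hd xs = a" "last xs = y" "\<forall>x \<in> set xs. P x" "successively r xs"
      by blast
    then show ?case using step(2)
      by (intro exI[of _ "xs @ [z]"]) (auto simp: successively_append_iff)
  qed
qed

text \<open>In a symmetric digraph, lying in different strong components means not being reachable
  from one another. Both ends are vertices because each lies in some component.\<close>

lemma separator_iff:
  assumes "pair_graph G"
  shows "separator G x y S \<longleftrightarrow> S \<subseteq> pverts G - {x, y} \<and> x \<in> pverts G \<and> y \<in> pverts G \<and>
    x \<notin> comp_of (parcs G) S y"
proof (cases "S \<subseteq> pverts G - {x, y}")
  case True
  interpret pair_graph G by fact
  define H where "H = del_verts G S"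
  interpret H: wf_digraph H
    unfolding H_def del_verts_def by (rule wellformed_induce_subgraph)
  have vH: "verts H = pverts G - S" by (simp add: H_def del_verts_def)
  have ends: "u \<in> pverts G \<and> v \<in> pverts G" if "(u, v) \<in> parcs G" for u v
    using in_arcsD1[OF that] in_arcsD2[OF that] by simp
  have aH: "arcs_ends H = avoiding (parcs G) S"
    unfolding H_def del_verts_def arcs_ends_conv avoiding_def
    using ends by (auto simp: image_iff)
  have sym: "symmetric H"
  proof -
    have "sym (parcs G)" using sym_arcs by (auto simp: symmetric_def arcs_ends_conv)
    then show ?thesis unfolding symmetric_def aH by (auto intro!: symI simp: avoiding_def dest:
        symD)
  qed
  have reach: "u \<rightarrow>\<^sup>*\<^bsub>H\<^esub> v \<longleftrightarrow> v \<in> comp_of (parcs G) S u \<and> u \<in> verts H \<and> v \<in> verts H" for u v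
    unfolding H.reachable_conv aH by (auto simp: comp_of_def)
  have scc: "(\<exists>C \<in> H.sccs_verts. \<exists>D \<in> H.sccs_verts. x \<in> C \<and> y \<in> D \<and> C \<noteq> D) \<longleftrightarrow>
     x \<in> verts H \<and> y \<in> verts H \<and> \<not> y \<rightarrow>\<^sup>*\<^bsub>H\<^esub> x"
  proof
    assume "\<exists>C \<in> H.sccs_verts. \<exists>D \<in> H.sccs_verts. x \<in> C \<and> y \<in> D \<and> C \<noteq> D"
    then obtain C D where CD: "C \<in> H.sccs_verts" "D \<in> H.sccs_verts" "x \<in> C" "y \<in> D" "C \<noteq> D" by blast
    have "\<not> y \<rightarrow>\<^sup>*\<^bsub>H\<^esub> x"
    proof
      assume "y \<rightarrow>\<^sup>*\<^bsub>H\<^esub> x"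
      moreover from this have "x \<rightarrow>\<^sup>*\<^bsub>H\<^esub> y" by (rule symmetric_reachable[OF sym])
      ultimately have "x \<in> D" using CD unfolding H.in_sccs_verts_conv_reachable by blast
      then show False using CD H.sccs_verts_disjoint by blast
    qed
    then show "x \<in> verts H \<and> y \<in> verts H \<and> \<not> y \<rightarrow>\<^sup>*\<^bsub>H\<^esub> x"
      using CD H.sccs_verts_subsets by blast
  next
    assume *: "x \<in> verts H \<and> y \<in> verts H \<and> \<not> y \<rightarrow>\<^sup>*\<^bsub>H\<^esub> x"
    then have "H.scc_of x \<noteq> H.scc_of y" "x \<in> H.scc_of x" "y \<in> H.scc_of y"
      using H.in_scc_of_self by (auto simp: H.scc_of_def)
    then show "\<exists>C \<in> H.sccs_verts. \<exists>D \<in> H.sccs_verts. x \<in> C \<and> y \<in> D \<and> C \<noteq> D"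
      using * H.scc_of_in_sccs_verts by blast
  qed
  have "separator G x y S \<longleftrightarrow> x \<in> verts H \<and> y \<in> verts H \<and> \<not> y \<rightarrow>\<^sup>*\<^bsub>H\<^esub> x"
    unfolding separator_def components_def H_def[symmetric] scc using True by simp
  also have "\<dots> \<longleftrightarrow> x \<in> verts H \<and> y \<in> verts H \<and> x \<notin> comp_of (parcs G) S y"
    unfolding reach by blast
  finally show ?thesis using True unfolding vH by auto
qed (auto simp: separator_def)

lemma st_graphI: "pair_graph G \<Longrightarrow> nonadjacent G s t \<Longrightarrow> st_graph (pverts G) (parcs G) s t"
proof -
  assume "pair_graph G" and na: "nonadjacent G s t"
  interpret pair_graph G by fact
  show ?thesis
  proof
    show "sym (parcs G)" using sym_arcs by (auto simp: symmetric_def arcs_ends_conv)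
  qed (use na in_arcsD1 in_arcsD2 in \<open>auto simp: nonadjacent_def\<close>)
qed

lemma separator_iff_is_sep:
  assumes "pair_graph G" "nonadjacent G s t"
  shows "separator G s t = st_graph.is_sep (pverts G) (parcs G) s t"
proof -
  interpret st_graph "pverts G" "parcs G" s t using assms by (rule st_graphI)
  show ?thesis
    using s_V t_V by (auto simp: fun_eq_iff separator_iff[OF assms(1)] is_sep_def)
qed

lemma minimal_separator_iff_is_minsep:
  assumes "pair_graph G" "nonadjacent G s t"
  shows "minimal_separator G s t = st_graph.is_minsep (pverts G) (parcs G) s t"
proof -
  interpret st_graph "pverts G" "parcs G" s t using assms by (rule st_graphI)
  show ?thesis
    by (simp add: fun_eq_iff minimal_separator_def is_minsep_def separator_iff_is_sep[OF assms])
qed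

lemma reconfigurable_iff_sep_step:
  assumes "pair_graph G" "nonadjacent G s t" "separator G s t A"
  shows "reconfigurable adj G s t A B \<longleftrightarrow>
    (A, B) \<in> (st_graph.sep_step (pverts G) (parcs G) s t adj)\<^sup>*"
proof -
  interpret st_graph "pverts G" "parcs G" s t using assms(1,2) by (rule st_graphI)
  show ?thesis
    using assms(3)
    by (simp add: reconfigurable_def successively_iff_rtrancl sep_step_def
        separator_iff_is_sep[OF assms(1,2)])
qed


section \<open>Algorithms on binary trees\<close>

subsection \<open>Trees as lists\<close>

abbreviation dset :: "data \<Rightarrow> data set" where
  "dset d \<equiv> set (elems d)"

lemma elems_inject: "elems a = elems b \<longleftrightarrow> a = b"
proof (induction a arbitrary: b)
  case Atom then show ?case by (cases b) auto
next
  case (Pair x xs) then show ?case by (cases b) auto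
qed

lemma size_elems: "size d = (\<Sum>x\<leftarrow>elems d. size x + 1)"
  by (induction d) auto

lemma length_elems_le: "length (elems d) \<le> size d"
  by (induction d) auto

lemma size_elem_le: "x \<in> dset d \<Longrightarrow> size x \<le> size d"
  by (induction d) auto

lemma elems_eq_Nil [simp]: "elems d = [] \<longleftrightarrow> d = Atom"
  by (cases d) auto

lemma elems_right: "elems (right d) = tl (elems d)"
  by (cases d) auto

lemma elems_enc_list [simp]: "elems (enc_list f xs) = map f xs"
  by (induction xs) (auto simp: enc_list_def)

lemma dfold_const: "dfold (\<lambda>_. f) l a = (f ^^ length (elems l)) a"
  by (induction l arbitrary: a) (auto simp: funpow_swap1)


subsection \<open>Folds with additive growth\<close>

text \<open>The increment depends on the element and the parameter but not on the accumulator, so a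
  fold sums its increments instead of compounding them.\<close>

definition additive_growth :: "(data \<Rightarrow> data \<Rightarrow> data \<Rightarrow> data) \<Rightarrow> bool" where
  "additive_growth b \<longleftrightarrow> (\<exists>k. \<forall>x a c. size (b x a c) \<le> size a + (size x + size c + 2) ^ k)"

lemma additive_growthI:
  assumes F: "poly_bounded UNIV (\<lambda>d. F (left d) (right d))"
    and b: "\<And>x a c. size (b x a c) \<le> size a + F x c"
  shows "additive_growth b"
proof -
  obtain k where k: "\<And>d. F (left d) (right d) \<le> (size d + 2) ^ k"
    using F unfolding poly_bounded_def by blast
  have "size (b x a c) \<le> size a + (size x + size c + 2) ^ (2 * k)" for x a c
  proof -
    \<comment> \<open>The pair of \<open>x\<close> and \<open>c\<close> costs one extra node;
      squaring the base absorbs it.\<close>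
    have "F x c \<le> (size x + size c + 3) ^ k" using k[of "Pair x c"] by (simp add: eval_nat_numeral)
    also have "\<dots> \<le> ((size x + size c + 2) ^ 2) ^ k"
      by (rule power_mono) (auto simp: power2_eq_square algebra_simps)
    finally show ?thesis using b[of x a c] by (simp add: power_mult)
  qed
  then show ?thesis unfolding additive_growth_def by blast
qed

lemma size_dfold_additive:
  assumes "\<And>x a. x \<in> dset l \<Longrightarrow> size (b x a) \<le> size a + m"
  shows "size (dfold b l a) \<le> size a + length (elems l) * m"
  using assms
proof (induction l arbitrary: a)
  case (Pair x xs)
  have "size (dfold b xs (b x a)) \<le> size (b x a) + length (elems xs) * m"
    by (rule Pair.IH) (use Pair.prems in auto)
  also have "size (b x a) \<le> size a + m" using Pair.prems by simp
  finally show ?case by (simp add: algebra_simps)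
qed simp

lemma accs_bounded_additive:
  assumes "\<And>x a. x \<in> set xs \<Longrightarrow> size (b x a) \<le> size a + m" "size a + length xs * m \<le> M"
  shows "accs_bounded M b xs a"
  using assms
proof (induction xs arbitrary: a)
  case (Cons x xs)
  have *: "size (b x a) \<le> size a + m" using Cons.prems by simp
  have "accs_bounded M b xs (b x a)"
  proof (rule Cons.IH)
    have "size a + (m + length xs * m) \<le> M" using Cons.prems(2) by simp
    with * show "size (b x a) + length xs * m \<le> M" by linarith
  qed (use Cons.prems(1) in simp)
  then show ?case using Cons.prems by simp
qed simp

lemma ptime_dfold_additive:
  assumes b: "ptime3 b" "additive_growth b" and l: "ptime D l" and a: "ptime D a" and c: "ptime D c"
  shows "ptime D (\<lambda>d. dfold (\<lambda>x y. b x y (c d)) (l d) (a d))"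
proof -
  obtain k where k: "\<And>x a c. size (b x a c) \<le> size a + (size x + size c + 2) ^ k"
    using b unfolding additive_growth_def by blast
  show ?thesis
  proof (rule ptime_dfold[OF b(1) l a c])
    show "poly_bounded D (\<lambda>d. size (a d) + size (l d) * (size (l d) + size (c d) + 2) ^ k)"
      by (intro poly_bounded_intros ptime_size l a c)
    show "accs_bounded (size (a d) + size (l d) * (size (l d) + size (c d) + 2) ^ k)
      (\<lambda>x y. b x y (c d)) (elems (l d)) (a d)" for d
    proof (rule accs_bounded_additive)
      show "size (b x a (c d)) \<le> size a + (size (l d) + size (c d) + 2) ^ k"
        if "x \<in> dset (l d)" for x a
        using k[of x a "c d"] power_mono[of "size x + size (c d) + 2" "size (l d) + size (c d) +
            2" k]
          size_elem_le[OF that] by simp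
    qed (simp add: length_elems_le)
  qed
qed

text \<open>This admits nested loops: the inner list and parameter come from \<open>x\<close> and
  \<open>c\<close> alone, so the total inner increment does not depend on the accumulator.\<close>

lemma additive_dfold:
  assumes b: "additive_growth b" and l: "ptime2 l" and g: "ptime2 g"
  shows "additive_growth (\<lambda>x a c. dfold (\<lambda>z y. b z y (g x c)) (l x c) a)"
proof -
  obtain k where k: "\<And>x a c. size (b x a c) \<le> size a + (size x + size c + 2) ^ k"
    using b unfolding additive_growth_def by blast
  show ?thesis
  proof (rule additive_growthI)
    show "poly_bounded UNIV (\<lambda>d. size (l (left d) (right d)) *
       (size (l (left d) (right d)) + size (g (left d) (right d)) + 2) ^ k)"
      using l g unfolding ptime2_def by (intro poly_bounded_intros ptime_size) auto
    fix x a c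
    have "size (dfold (\<lambda>z y. b z y (g x c)) (l x c) a)
      \<le> size a + length (elems (l x c)) * (size (l x c) + size (g x c) + 2) ^ k"
    proof (rule size_dfold_additive)
      show "size (b z a (g x c)) \<le> size a + (size (l x c) + size (g x c) + 2) ^ k"
        if "z \<in> dset (l x c)" for z a
        using k[of z a "g x c"] power_mono[of "size z + size (g x c) + 2" "size (l x c) + size (g
            x c) + 2" k]
          size_elem_le[OF that] by simp
    qed
    also have "\<dots> \<le> size a + size (l x c) * (size (l x c) + size (g x c) + 2) ^ k"
      by (simp add: length_elems_le)
    finally show "size (dfold (\<lambda>z y. b z y (g x c)) (l x c) a)
      \<le> size a + size (l x c) * (size (l x c) + size (g x c) + 2) ^ k" .
  qed
qed

lemma poly_bounded_size_left: "poly_bounded D (\<lambda>d. size (left d))"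
  and poly_bounded_size_right: "poly_bounded D (\<lambda>d. size (right d))"
  by (rule poly_bounded_mono[OF poly_bounded_size], simp add: size_left_le size_right_le)+

lemma additive_growth_simpleI:
  assumes "\<And>x a c. size (b x a c) \<le> size a + (size x + size c + k)"
  shows "additive_growth b"
  by (rule additive_growthI[OF _ assms])
    (intro poly_bounded_intros poly_bounded_size_left poly_bounded_size_right)

lemma ptime2I: "ptime UNIV (\<lambda>d. f (left d) (right d)) \<Longrightarrow> ptime2 f"
  by (simp add: ptime2_def)

lemma ptime3I: "ptime UNIV (\<lambda>d. f (left d) (left (right d)) (right (right d))) \<Longrightarrow> ptime3 f"
  by (simp add: ptime3_def)

lemmas ptime_intros = ptime2I ptime3I ptime_id ptime_Atom ptime_Pair ptime_left ptime_right ptime_if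
  ptime2D[OF ptime2_deq]


subsection \<open>Sets\<close>

definition dmem :: "data \<Rightarrow> data \<Rightarrow> data" where
  "dmem x l = dfold (\<lambda>y acc. if deq x y = Atom then acc else Pair Atom Atom) l Atom"

lemma dmem_eq_Atom [simp]: "dmem x l = Atom \<longleftrightarrow> x \<notin> dset l"
proof -
  have "dfold (\<lambda>y acc. if deq x y = Atom then acc else Pair Atom Atom) l a = Atom \<longleftrightarrow>
    a = Atom \<and> x \<notin> dset l" for a
    by (induction l arbitrary: a) (auto simp: deq_def)
  then show ?thesis by (simp add: dmem_def)
qed

lemma ptime_dmem: "ptime D f \<Longrightarrow> ptime D g \<Longrightarrow> ptime D (\<lambda>d. dmem (f d) (g d))"
  unfolding dmem_def
  by (rule ptime_dfold_additive[where b = "\<lambda>y acc x. if deq x y = Atom then acc else Pair Atom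
      Atom"])
    (assumption | (intro ptime_intros additive_growth_simpleI[where k = 1]; simp))+

text \<open>Inserting without repetition makes list length a cardinality and keeps rediscovered
  separators from enlarging the enumeration.\<close>

definition dins :: "data \<Rightarrow> data \<Rightarrow> data" where
  "dins x l = (if dmem x l = Atom then Pair x l else l)"

lemma dset_dins [simp]: "dset (dins x l) = insert x (dset l)"
  by (auto simp: dins_def)

lemma distinct_dins [simp]: "distinct (elems (dins x l)) \<longleftrightarrow> distinct (elems l)"
  by (auto simp: dins_def)

lemma size_dins_le: "size (dins x l) \<le> size l + size x + 1"
  by (simp add: dins_def)

lemma ptime_dins: "ptime D f \<Longrightarrow> ptime D g \<Longrightarrow> ptime D (\<lambda>d. dins (f d) (g d))"
  unfolding dins_def by (intro ptime_intros ptime_dmem)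

definition dunion :: "data \<Rightarrow> data \<Rightarrow> data" where
  "dunion a b = dfold dins a b"

lemma dset_dunion [simp]: "dset (dunion a b) = dset a \<union> dset b"
  unfolding dunion_def by (induction a arbitrary: b) auto

lemma distinct_dunion [simp]: "distinct (elems (dunion a b)) \<longleftrightarrow> distinct (elems b)"
  unfolding dunion_def by (induction a arbitrary: b) auto

lemma ptime_dunion: "ptime D f \<Longrightarrow> ptime D g \<Longrightarrow> ptime D (\<lambda>d. dunion (f d) (g d))"
  unfolding dunion_def
  by (rule ptime_dfold_additive[where b = "\<lambda>x a c. dins x a" and c = "\<lambda>_. Atom"])
    (assumption | (intro ptime_intros ptime_dins additive_growth_simpleI[where k = 1]; simp add:
        order_trans[OF size_dins_le]))+

text \<open>
  \<open>dselect v l\<close> is a normal form of the set \<open>dset l \<inter> dset v\<close>: equal sets become equal trees.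
\<close>

definition dselect :: "data \<Rightarrow> data \<Rightarrow> data" where
  "dselect v l = dfold (\<lambda>x acc. if dmem x l = Atom then acc else Pair x acc) v Atom"

lemma elems_dselect: "elems (dselect v l) = rev (filter (\<lambda>x. x \<in> dset l) (elems v))"
proof -
  have "elems (dfold (\<lambda>x acc. if dmem x l = Atom then acc else Pair x acc) v a) =
    rev (filter (\<lambda>x. x \<in> dset l) (elems v)) @ elems a" for a
    by (induction v arbitrary: a) auto
  then show ?thesis by (simp add: dselect_def)
qed

lemma ptime_dselect: "ptime D f \<Longrightarrow> ptime D g \<Longrightarrow> ptime D (\<lambda>d. dselect (f d) (g d))"
  unfolding dselect_def
  by (rule ptime_dfold_additive[where b = "\<lambda>x acc l. if dmem x l = Atom then acc else Pair x acc"])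
    (assumption | (intro ptime_intros ptime_dmem additive_growth_simpleI[where k = 1]; simp))+

subsection \<open>Graphs\<close>

text \<open>\<open>left\<close> and \<open>right\<close> are total, so every entry counts as an arc
  and no well-formedness condition on \<open>e\<close> arises.\<close>

definition dpairs :: "data \<Rightarrow> (data \<times> data) set" where
  "dpairs e = (\<lambda>p. (left p, right p)) ` dset e"

lemma dpairs_Pair: "dpairs (Pair p e) = insert (left p, right p) (dpairs e)"
  by (simp add: dpairs_def)

definition davoid :: "data \<Rightarrow> data \<Rightarrow> data" where
  "davoid e x = dfold (\<lambda>p acc. if dmem (left p) x = Atom
     then if dmem (right p) x = Atom then Pair p acc else acc else acc) e Atom"

lemma dpairs_davoid: "dpairs (davoid e x) = avoiding (dpairs e) (dset x)"
proof -
  have "dset (dfold (\<lambda>p acc. if dmem (left p) x = Atom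
     then if dmem (right p) x = Atom then Pair p acc else acc else acc) e a) =
     {p \<in> dset e. left p \<notin> dset x \<and> right p \<notin> dset x} \<union> dset a" for a
    by (induction e arbitrary: a) auto
  from this[of Atom] show ?thesis
    by (auto simp: davoid_def dpairs_def avoiding_def)
qed

lemma ptime_davoid: "ptime D f \<Longrightarrow> ptime D g \<Longrightarrow> ptime D (\<lambda>d. davoid (f d) (g d))"
  unfolding davoid_def
  by (rule ptime_dfold_additive[where b = "\<lambda>p acc x. if dmem (left p) x = Atom
     then if dmem (right p) x = Atom then Pair p acc else acc else acc"])
    (assumption | (intro ptime_intros ptime_dmem additive_growth_simpleI[where k = 1]; simp))+

definition dnbrs :: "data \<Rightarrow> data \<Rightarrow> data" where
  "dnbrs e c = dfold (\<lambda>p acc. if dmem (left p) c = Atom then acc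
     else if dmem (right p) c = Atom then Pair (right p) acc else acc) e Atom"

lemma dset_dnbrs [simp]: "dset (dnbrs e c) = nbrs (dpairs e) (dset c)"
proof -
  have "dset (dfold (\<lambda>p acc. if dmem (left p) c = Atom then acc
     else if dmem (right p) c = Atom then Pair (right p) acc else acc) e a) =
     {right p | p. p \<in> dset e \<and> left p \<in> dset c \<and> right p \<notin> dset c} \<union> dset a" for a
    by (induction e arbitrary: a) auto
  from this[of Atom] show ?thesis
    by (auto simp: dnbrs_def dpairs_def nbrs_def)
qed

lemma ptime_dnbrs: "ptime D f \<Longrightarrow> ptime D g \<Longrightarrow> ptime D (\<lambda>d. dnbrs (f d) (g d))"
  unfolding dnbrs_def
  by (rule ptime_dfold_additive[where b = "\<lambda>p acc c. if dmem (left p) c = Atom then acc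
     else if dmem (right p) c = Atom then Pair (right p) acc else acc"])
    (assumption | (intro ptime_intros ptime_dmem additive_growth_simpleI[where k = 1]; simp add:
        size_right_le trans_le_add1))+

definition dspread :: "data \<Rightarrow> data \<Rightarrow> data" where
  "dspread e r = dfold (\<lambda>p acc. if dmem (left p) acc = Atom then acc else dins (right p) acc) e r"

text \<open>A vertex added during a pass may already trigger later arcs, so the outcome depends on
  the order of the arcs. It is located only between one step and the closure, which is enough for
  the iteration.\<close>

lemma dset_dspread:
  shows "dset r \<union> dpairs e `` dset r \<subseteq> dset (dspread e r)"
    and "dset r \<subseteq> C \<Longrightarrow> dpairs e `` C \<subseteq> C \<Longrightarrow> dset (dspread e r) \<subseteq> C"
proof -
  show "dset r \<union> dpairs e `` dset r \<subseteq> dset (dspread e r)"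
    unfolding dspread_def
  proof (induction e arbitrary: r)
    case (Pair p e)
    define r' where "r' = (if dmem (left p) r = Atom then r else dins (right p) r)"
    have "dset r \<union> dpairs (Pair p e) `` dset r \<subseteq> dset r' \<union> dpairs e `` dset r'"
      by (auto simp: r'_def dpairs_Pair)
    also note Pair.IH(2)[of r']
    finally show ?case by (simp add: r'_def)
  qed (simp add: dpairs_def)
  show "dset r \<subseteq> C \<Longrightarrow> dpairs e `` C \<subseteq> C \<Longrightarrow> dset (dspread e r) \<subseteq> C"
    unfolding dspread_def
  proof (induction e arbitrary: r)
    case (Pair p e)
    define r' where "r' = (if dmem (left p) r = Atom then r else dins (right p) r)"
    have "dset r' \<subseteq> C" "dpairs e `` C \<subseteq> C"
      using Pair.prems by (auto simp: r'_def dpairs_Pair)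
    from Pair.IH(2)[OF this] show ?case by (simp add: r'_def)
  qed simp
qed

lemma additive_dspread_step:
  "additive_growth (\<lambda>p acc c. if dmem (left p) acc = Atom then acc else dins (right p) acc)"
  by (rule additive_growth_simpleI[where k = 1])
    (simp add: order_trans[OF size_dins_le] size_right_le trans_le_add1)

lemma ptime_dspread: "ptime D f \<Longrightarrow> ptime D g \<Longrightarrow> ptime D (\<lambda>d. dspread (f d) (g d))"
  unfolding dspread_def
  by (rule ptime_dfold_additive[where c = "\<lambda>_. Atom", OF _ additive_dspread_step])
    (assumption | intro ptime_intros ptime_dmem ptime_dins)+

definition dreach :: "data \<Rightarrow> data \<Rightarrow> data" where
  "dreach e t = dfold (\<lambda>_. dspread e) e (Pair t Atom)"

text \<open>Until the set is closed, each pass adds a vertex. It starts with one and stays within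
  \<open>t\<close> and the heads of arcs, at most one more than there are arcs, so one pass per arc
  suffices.\<close>

lemma dset_dreach [simp]: "dset (dreach e t) = (dpairs e)\<^sup>* `` {t}"
proof -
  define R where "R i = dset ((dspread e ^^ i) (Pair t Atom))" for i
  have mono: "R i \<union> dpairs e `` R i \<subseteq> R (Suc i)" for i
    using dset_dspread(1)[of "(dspread e ^^ i) (Pair t Atom)" e] by (simp add: R_def)
  have least: "R i \<subseteq> C" if "t \<in> C" "dpairs e `` C \<subseteq> C" for i C
  proof (induction i)
    case 0
    show ?case using that by (simp add: R_def)
  next
    case (Suc i)
    then show ?case
      using that dset_dspread(2)[of "(dspread e ^^ i) (Pair t Atom)" C e] by (simp add: R_def)
  qed
  define W where "W = insert t (snd ` dpairs e)"
  have W: "R i \<subseteq> W" for i by (rule least) (force simp: W_def)+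
  have finW: "finite W" by (simp add: W_def dpairs_def)
  have cardW: "card W \<le> Suc (length (elems e))"
  proof -
    have "card (snd ` dpairs e) \<le> length (elems e)"
      unfolding dpairs_def image_image
      by (rule order_trans[OF card_image_le[OF finite_set] card_length])
    then show ?thesis
      unfolding W_def using card_insert_le_m1 by (simp add: card_insert_if dpairs_def)
  qed
  have grow: "dpairs e `` R i \<subseteq> R i \<or> i < card (R i)" for i
  proof (induction i)
    case 0
    show ?case by (simp add: R_def)
  next
    case (Suc i)
    show ?case
    proof (cases "dpairs e `` R i \<subseteq> R i")
      case True
      then have "R (Suc i) \<subseteq> R i"
        using dset_dspread(2)[of "(dspread e ^^ i) (Pair t Atom)" "R i" e] by (simp add: R_def)
      then have "R (Suc i) = R i" using mono[of i] by blast
      then show ?thesis using True by simp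
    next
      case False
      then have "R i \<subset> R (Suc i)" using mono[of i] by blast
      then have "card (R i) < card (R (Suc i))" by (rule psubset_card_mono[rotated]) (simp add:
          R_def)
      then show ?thesis using Suc False by auto
    qed
  qed
  let ?n = "length (elems e)"
  have closed: "dpairs e `` R ?n \<subseteq> R ?n"
  proof (rule disjE[OF grow[of ?n]])
    assume "?n < card (R ?n)"
    then have "R ?n = W" using W[of ?n] finW cardW by (metis card_seteq le_trans Suc_leI)
    then show ?thesis by (force simp: W_def)
  qed
  have t: "t \<in> R i" for i using mono by (induction i) (auto simp: R_def)
  have "R ?n = (dpairs e)\<^sup>* `` {t}"
  proof
    show "R ?n \<subseteq> (dpairs e)\<^sup>* `` {t}" by (rule least) (auto intro: rtrancl_into_rtrancl)
    have "u \<in> R ?n" if "(t, u) \<in> (dpairs e)\<^sup>*" for u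
      using that by (induction rule: rtrancl_induct) (use t closed in auto)
    then show "(dpairs e)\<^sup>* `` {t} \<subseteq> R ?n" by blast
  qed
  then show ?thesis by (simp add: R_def dreach_def dfold_const)
qed

lemma ptime_dreach:
  assumes "ptime D f" "ptime D g" shows "ptime D (\<lambda>d. dreach (f d) (g d))"
proof -
  have "additive_growth (\<lambda>x a c. dspread c a)"
    unfolding dspread_def
    by (rule additive_dfold[OF additive_dspread_step, of "\<lambda>x c. c" "\<lambda>x c. Atom"])
      (intro ptime_intros)+
  moreover have "ptime3 (\<lambda>x a c. dspread c a)"
    by (intro ptime_intros ptime_dspread)
  ultimately show ?thesis
    unfolding dreach_def using assms
    by (intro ptime_dfold_additive[of "\<lambda>x a c. dspread c a" D f _ f] ptime_intros ptime_dspread)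
qed

text \<open>Normalising by \<open>dselect\<close> turns equal separators into equal trees, so
  \<open>dins\<close> recognises repetitions.\<close>

definition dcore :: "data \<Rightarrow> data \<Rightarrow> data \<Rightarrow> data \<Rightarrow> data" where
  "dcore v e t x = dselect v (dnbrs e (dreach (davoid e x) t))"

lemma elems_dcore: "elems (dcore v e t x) = rev (filter (\<lambda>x'. x' \<in> core (dpairs e) t (dset x))
    (elems v))"
  by (simp add: dcore_def elems_dselect dpairs_davoid core_def comp_of_def)

lemma ptime_dcore:
  "ptime D f \<Longrightarrow> ptime D g \<Longrightarrow> ptime D h \<Longrightarrow> ptime D k \<Longrightarrow> ptime D (\<lambda>d. dcore (f d) (g d) (h d) (k d))"
  unfolding dcore_def by (intro ptime_dselect ptime_dnbrs ptime_dreach ptime_davoid)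


subsection \<open>Comparing cardinalities\<close>

text \<open>Here \<open>Atom\<close> means that the inequality holds: the result is what remains of
  \<open>a\<close> after removing one entry per entry of \<open>b\<close>. \<open>dle_bin\<close>
  follows the same convention.\<close>

definition dle :: "data \<Rightarrow> data \<Rightarrow> data" where
  "dle a b = dfold (\<lambda>_. right) b a"

lemma dle_eq_Atom [simp]: "dle a b = Atom \<longleftrightarrow> length (elems a) \<le> length (elems b)"
proof -
  have "elems ((right ^^ n) a) = drop n (elems a)" for n
    by (induction n) (simp_all add: elems_right drop_Suc tl_drop)
  then have "elems (dle a b) = drop (length (elems b)) (elems a)"
    by (simp add: dle_def dfold_const)
  then show ?thesis by (metis drop_eq_Nil elems_eq_Nil)
qed

lemma ptime_dle: "ptime D f \<Longrightarrow> ptime D g \<Longrightarrow> ptime D (\<lambda>d. dle (f d) (g d))"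
  unfolding dle_def
  by (rule ptime_dfold_additive[where b = "\<lambda>x a c. right a" and c = "\<lambda>_. Atom"])
    (assumption | (intro ptime_intros additive_growth_simpleI[where k = 0]; simp add:
        size_right_le trans_le_add1))+

text \<open>The accumulator pairs the parity of the number of entries read with half that number,
  rounded down, in unary.\<close>

definition dhalf :: "data \<Rightarrow> data" where
  "dhalf l = right (dfold (\<lambda>_ acc. if left acc = Atom then Pair (Pair Atom Atom) (right acc)
     else Pair Atom (Pair Atom (right acc))) l (Pair Atom Atom))"

lemma dhalf_eq: "dhalf l = (Pair Atom ^^ (length (elems l) div 2)) Atom"
proof -
  have "dfold (\<lambda>_ acc. if left acc = Atom then Pair (Pair Atom Atom) (right acc)
     else Pair Atom (Pair Atom (right acc))) l (Pair (dbool (odd m)) ((Pair Atom ^^ (m div 2))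
         Atom)) =
     Pair (dbool (odd (m + length (elems l)))) ((Pair Atom ^^ ((m + length (elems l)) div 2))
         Atom)" for m
  proof (induction l arbitrary: m)
    case (Pair x xs)
    show ?case using Pair.IH(2)[of "Suc m"] by (cases "even m") (simp_all add: dbool_def)
  qed simp
  from this[of 0] show ?thesis by (simp add: dhalf_def dbool_def)
qed

lemma size_unary: "size ((Pair Atom ^^ n) Atom) = n"
  and length_elems_unary: "length (elems ((Pair Atom ^^ n) Atom)) = n"
  by (induction n) simp_all

lemma ptime_dhalf: "ptime D f \<Longrightarrow> ptime D (\<lambda>d. dhalf (f d))"
  unfolding dhalf_def
  by (rule ptime_right, rule ptime_dfold_additive[where c = "\<lambda>_. Atom" and
        b = "\<lambda>x acc c. if left acc = Atom then Pair (Pair Atom Atom) (right acc)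
     else Pair Atom (Pair Atom (right acc))"])
    (assumption | (intro ptime_intros additive_growth_simpleI[where k = 2]; simp add:
        size_right_le trans_le_add1))+

text \<open>
  A list is compared with a binary number by halving the list once for every bit, rounding up
  at a zero bit and down at a one bit.
\<close>

definition dle_bin :: "data \<Rightarrow> data \<Rightarrow> data" where
  "dle_bin l k = dfold (\<lambda>b acc. if b = Atom then dhalf (Pair Atom acc) else dhalf acc) k l"

text \<open>For \<open>k = 2 * q\<close>, \<open>n \<le> k\<close> means
  \<open>(n + 1) div 2 \<le> q\<close>; for \<open>k = 2 * q + 1\<close> it means
  \<open>n div 2 \<le> q\<close>.\<close>

lemma dle_bin_eq_Atom: "dle_bin l (enc_nat k) = Atom \<longleftrightarrow> length (elems l) \<le> k"
proof (induction k arbitrary: l rule: less_induct)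
  case (less k)
  show ?case
  proof (cases "k = 0")
    case True
    then show ?thesis by (simp add: dle_bin_def enc_nat.simps[of 0] flip: elems_eq_Nil)
  next
    case False
    have "dle_bin l (enc_nat k) =
        dle_bin (if odd k then dhalf l else dhalf (Pair Atom l)) (enc_nat (k div 2))"
      using False by (simp add: dle_bin_def enc_nat.simps[of k])
    also have "\<dots> = Atom \<longleftrightarrow> length (elems (if odd k then dhalf l else dhalf (Pair Atom l))) \<le> k div 2"
      using False by (intro less.IH) simp
    also have "\<dots> \<longleftrightarrow> length (elems l) \<le> k"
      by (auto simp: dhalf_eq length_elems_unary) presburger+
    finally show ?thesis .
  qed
qed

lemma ptime_dle_bin: "ptime D f \<Longrightarrow> ptime D g \<Longrightarrow> ptime D (\<lambda>d. dle_bin (f d) (g d))"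
proof -
  have half: "(length (elems a) + j) div 2 \<le> size a" if "j \<le> 1" for a j
    using length_elems_le[of a] that by linarith
  have "additive_growth (\<lambda>b acc c. if b = Atom then dhalf (Pair Atom acc) else dhalf acc)"
    by (rule additive_growth_simpleI[where k = 0])
      (use half[of 0] half[of 1] in \<open>simp add: dhalf_eq size_unary trans_le_add1\<close>)
  moreover have "ptime3 (\<lambda>b acc c. if b = Atom then dhalf (Pair Atom acc) else dhalf acc)"
    by (intro ptime_intros ptime_dhalf)
  ultimately show "ptime D f \<Longrightarrow> ptime D g \<Longrightarrow> ?thesis"
    unfolding dle_bin_def
    by (intro ptime_dfold_additive[where c = "\<lambda>_. Atom" and
          b = "\<lambda>b acc c. if b = Atom then dhalf (Pair Atom acc) else dhalf acc"] ptime_Atom)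
qed

text \<open>A number can be exponential in the length of its binary encoding, so it is written in
  unary only up to the number of vertices; \<open>links_min_card\<close> shows that this cap is
  harmless.\<close>

definition dcap :: "data \<Rightarrow> data \<Rightarrow> data" where
  "dcap v k = dfold (\<lambda>_ acc. if dle_bin (Pair Atom acc) k = Atom then Pair Atom acc else acc) v
      Atom"

lemma length_dcap: "length (elems (dcap v (enc_nat k))) = min k (length (elems v))"
proof -
  have "length (elems (dfold (\<lambda>_ acc. if dle_bin (Pair Atom acc) (enc_nat k) = Atom then Pair
      Atom acc
      else acc) v a)) = min k (length (elems a) + length (elems v))" if "length (elems a) \<le> k" for a
    using that by (induction v arbitrary: a) (auto simp: dle_bin_eq_Atom)
  from this[of Atom] show ?thesis by (simp add: dcap_def)
qed

lemma ptime_dcap: "ptime D f \<Longrightarrow> ptime D g \<Longrightarrow> ptime D (\<lambda>d. dcap (f d) (g d))"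
  unfolding dcap_def
  by (rule ptime_dfold_additive[where
        b = "\<lambda>x acc k. if dle_bin (Pair Atom acc) k = Atom then Pair Atom acc else acc"])
    (assumption | (intro ptime_intros ptime_dle_bin additive_growth_simpleI[where k = 1]; simp))+


subsection \<open>Enumerating separators\<close>

text \<open>In what follows \<open>c\<close> is the tuple of the vertex list, the arc list and the vertex \<open>t\<close>.\<close>

definition dnext :: "data \<Rightarrow> data \<Rightarrow> data \<Rightarrow> data" where
  "dnext c S x = dcore (left c) (left (right c)) (right (right c))
     (dunion (dnbrs (left (right c)) (Pair x Atom)) S)"

lemma ptime_dnext:
  "ptime D f \<Longrightarrow> ptime D g \<Longrightarrow> ptime D h \<Longrightarrow> ptime D (\<lambda>d. dnext (f d) (g d) (h d))"
  unfolding dnext_def by (intro ptime_dcore ptime_dunion ptime_dnbrs ptime_intros)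

text \<open>\<open>p\<close> packs the separator with the tuple \<open>c\<close>, as a fold body
  carries a single parameter.\<close>

definition dnext_ins :: "data \<Rightarrow> data \<Rightarrow> data \<Rightarrow> data" where
  "dnext_ins x acc p =
     (if dmem (right (right (right p))) (dnbrs (left (right (right p))) (Pair x Atom)) = Atom
      then dins (dnext (right p) (left p) x) acc else acc)"

lemma ptime_dnext_ins:
  "ptime D f \<Longrightarrow> ptime D g \<Longrightarrow> ptime D h \<Longrightarrow> ptime D (\<lambda>d. dnext_ins (f d) (g d) (h d))"
  unfolding dnext_ins_def by (intro ptime_intros ptime_dmem ptime_dnbrs ptime_dins ptime_dnext)

lemma additive_growth_dnext_ins: "additive_growth dnext_ins"
proof (rule additive_growthI)
  show "poly_bounded UNIV (\<lambda>d. size (dnext (right (right d)) (left (right d)) (left d)) + 1)"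
    by (intro poly_bounded_intros ptime_size ptime_dnext ptime_intros)
  show "size (dnext_ins x a c) \<le> size a + (size (dnext (right c) (left c) x) + 1)" for x a c
    using size_dins_le[of "dnext (right c) (left c) x" a] by (simp add: dnext_ins_def)
qed

text \<open>The outer loop reads the list of the previous round while additions go to the
  accumulator, so a new separator is expanded only in the next round.\<close>

definition dround :: "data \<Rightarrow> data \<Rightarrow> data" where
  "dround c L = dfold (\<lambda>S acc. dfold (\<lambda>x acc. dnext_ins x acc (Pair S c)) S acc) L L"

lemma ptime_dround:
  assumes f: "ptime D f" and g: "ptime D g" shows "ptime D (\<lambda>d. dround (f d) (g d))"
proof -
  let ?b = "\<lambda>S acc c. dfold (\<lambda>x acc. dnext_ins x acc (Pair S c)) S acc"
  have add: "additive_growth ?b"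
    by (rule additive_dfold[OF additive_growth_dnext_ins, of "\<lambda>S c. S" "\<lambda>S c. Pair S c"])
      (intro ptime_intros)+
  have ins: "ptime3 dnext_ins" by (intro ptime_intros ptime_dnext_ins)
  have "ptime3 ?b"
    by (intro ptime3I ptime_dfold_additive[OF ins additive_growth_dnext_ins] ptime_intros)
  from ptime_dfold_additive[OF this add g g f] show ?thesis by (simp add: dround_def)
qed

lemma dset_dfold_UN:
  assumes "\<And>x a. x \<in> dset l \<Longrightarrow> dset (b x a) = dset a \<union> f x"
  shows "dset (dfold b l a) = dset a \<union> (\<Union>x \<in> dset l. f x)"
  using assms by (induction l arbitrary: a) auto

lemma distinct_dfold:
  assumes "\<And>x a. distinct (elems (b x a)) \<longleftrightarrow> distinct (elems a)"
  shows "distinct (elems (dfold b l a)) \<longleftrightarrow> distinct (elems a)"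
  using assms by (induction l arbitrary: a) auto

lemma distinct_dround: "distinct (elems (dround c L)) \<longleftrightarrow> distinct (elems L)"
  unfolding dround_def by (intro distinct_dfold) (simp add: dnext_ins_def)

lemma dset_dround:
  "dset (dround c L) = dset L \<union> (\<Union>S \<in> dset L. \<Union>x \<in> dset S.
     if right (right c) \<in> nbrs (dpairs (left (right c))) {x} then {} else {dnext c S x})"
  unfolding dround_def by (intro dset_dfold_UN) (auto simp: dnext_ins_def)

definition denum :: "data \<Rightarrow> data \<Rightarrow> data" where
  "denum c s = dfold (\<lambda>_. dround c) (left c)
     (Pair (dcore (left c) (left (right c)) (right (right c)) (dnbrs (left (right c)) (Pair s
         Atom))) Atom)"

lemma accs_bounded_const:
  "(\<And>i. size ((f ^^ i) a) \<le> M) \<Longrightarrow> accs_bounded M (\<lambda>_. f) xs a"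
proof (induction xs arbitrary: a)
  case Nil
  then show ?case using Nil[of 0] by simp
next
  case (Cons x xs)
  have "size ((f ^^ i) (f a)) \<le> M" for i using Cons.prems[of "Suc i"] by (simp add: funpow_swap1)
  then show ?case using Cons.IH Cons.prems[of 0] by simp
qed

text \<open>The increment of a round depends on the list being extended, so additive growth does not
  cover the iteration. The bound on all iterates is assumed here and later derived from the number
  of minimal separators.\<close>

lemma ptime_denum:
  assumes c: "ptime D c" and s: "ptime D s" and M: "poly_bounded D M"
    and bound: "\<And>d i. d \<in> D \<Longrightarrow> size ((dround (c d) ^^ i) (Pair (dcore (left (c d)) (left (right (c
        d)))
       (right (right (c d))) (dnbrs (left (right (c d))) (Pair (s d) Atom))) Atom)) \<le> M d"
  shows "ptime D (\<lambda>d. denum (c d) (s d))"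
  unfolding denum_def
proof (rule ptime_dfold[where b = "\<lambda>x L c. dround c L", OF _ _ _ c M accs_bounded_const[OF bound]])
  show "ptime3 (\<lambda>x L c. dround c L)" by (intro ptime_intros ptime_dround)
qed (intro ptime_intros ptime_dcore ptime_dnbrs c s)+


subsection \<open>Deciding connectivity\<close>

definition dkeep :: "data \<Rightarrow> data \<Rightarrow> data" where
  "dkeep k L = dfold (\<lambda>S acc. if dle S k = Atom then Pair S acc else acc) L Atom"

lemma dset_dkeep: "dset (dkeep k L) = {S \<in> dset L. length (elems S) \<le> length (elems k)}"
proof -
  have "dset (dkeep k L) =
      dset Atom \<union> (\<Union>S \<in> dset L. if length (elems S) \<le> length (elems k) then {S} else {})"
    unfolding dkeep_def by (rule dset_dfold_UN) auto
  then show ?thesis by auto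
qed

lemma ptime_dkeep: "ptime D f \<Longrightarrow> ptime D g \<Longrightarrow> ptime D (\<lambda>d. dkeep (f d) (g d))"
  unfolding dkeep_def
  by (rule ptime_dfold_additive[where b = "\<lambda>S acc k. if dle S k = Atom then Pair S acc else acc"])
    (assumption | (intro ptime_intros ptime_dle additive_growth_simpleI[where k = 1]; simp))+

definition dlink_ins :: "data \<Rightarrow> data \<Rightarrow> data \<Rightarrow> data" where
  "dlink_ins Y acc p =
     (if dle (dunion (left p) Y) (right p) = Atom then Pair (Pair (left p) Y) acc else acc)"

lemma additive_growth_dlink_ins: "additive_growth dlink_ins"
proof (rule additive_growth_simpleI)
  show "size (dlink_ins Y acc p) \<le> size acc + (size Y + size p + 2)" for Y acc p
    using size_left_le[of p] by (simp add: dlink_ins_def)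
qed

definition dlinks :: "data \<Rightarrow> data \<Rightarrow> data" where
  "dlinks n m = dfold (\<lambda>X acc. dfold (\<lambda>Y acc. dlink_ins Y acc (Pair X m)) n acc) n Atom"

lemma dpairs_dlinks:
  "dpairs (dlinks n m) =
     {(X, Y). X \<in> dset n \<and> Y \<in> dset n \<and> length (elems (dunion X Y)) \<le> length (elems m)}"
proof -
  have "dset (dlinks n m) = dset Atom \<union> (\<Union>X \<in> dset n. \<Union>Y \<in> dset n.
      if length (elems (dunion X Y)) \<le> length (elems m) then {Pair X Y} else {})"
    unfolding dlinks_def by (intro dset_dfold_UN) (auto simp: dlink_ins_def)
  then show ?thesis by (force simp: dpairs_def split: if_splits)
qed

lemma ptime_dlinks:
  assumes f: "ptime D f" and g: "ptime D g" shows "ptime D (\<lambda>d. dlinks (f d) (g d))"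
proof -
  \<comment> \<open>The parameter is the pair of \<open>n\<close> and \<open>m\<close>, since the
    inner loop runs over \<open>n\<close> again.\<close>
  let ?b = "\<lambda>X acc c. dfold (\<lambda>Y acc. dlink_ins Y acc (Pair X (right c))) (left c) acc"
  have add: "additive_growth ?b"
    by (rule additive_dfold[OF additive_growth_dlink_ins, of "\<lambda>X c. left c" "\<lambda>X c. Pair X (right
        c)"])
      (intro ptime_intros)+
  have ins: "ptime3 dlink_ins"
    unfolding dlink_ins_def by (intro ptime_intros ptime_dle ptime_dunion)
  have "ptime3 ?b"
    by (intro ptime3I ptime_dfold_additive[OF ins additive_growth_dlink_ins] ptime_intros)
  from ptime_dfold_additive[OF this add f ptime_Atom ptime_Pair[OF f g]]
  show ?thesis by (simp add: dlinks_def)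
qed

text \<open>The lists \<open>k\<close> and \<open>m\<close> stand for their lengths. Normalising
  \<open>a\<close> and \<open>b\<close> makes them nodes of the link graph, so reachability is
  membership of a tree.\<close>

definition ddecide :: "data \<Rightarrow> data \<Rightarrow> data \<Rightarrow> data \<Rightarrow> data \<Rightarrow> data \<Rightarrow> data" where
  "ddecide c s a b k m = dmem (dselect (left c) b) (dreach (dlinks (Pair (dselect (left c) a)
     (Pair (dselect (left c) b) (dkeep k (denum c s)))) m) (dselect (left c) a))"

lemma ptime_ddecide:
  assumes "ptime D (\<lambda>d. denum (c d) (s d))"
    and "ptime D c" "ptime D a" "ptime D b" "ptime D k" "ptime D m"
  shows "ptime D (\<lambda>d. ddecide (c d) (s d) (a d) (b d) (k d) (m d))"
  unfolding ddecide_def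
  by (intro ptime_dmem ptime_dselect ptime_dreach ptime_dlinks ptime_dkeep ptime_intros assms)


section \<open>Correctness of the algorithm on encoded instances\<close>

lemma enc_nat_inject: "enc_nat m = enc_nat n \<Longrightarrow> m = n"
proof (induction m arbitrary: n rule: less_induct)
  case (less m)
  show ?case
  proof (cases "m = 0 \<or> n = 0")
    case True
    then show ?thesis using less.prems by (subst (asm) enc_nat.simps, subst (asm) (2)
        enc_nat.simps) (auto split: if_splits)
  next
    case False
    then have "(if odd m then Pair Atom Atom else Atom) = (if odd n then Pair Atom Atom else Atom)"
      and "enc_nat (m div 2) = enc_nat (n div 2)"
      using less.prems enc_nat.simps[of m] enc_nat.simps[of n] by simp_all
    then have "odd m = odd n" "m div 2 = n div 2"
      using less.IH[of "m div 2" "n div 2"] False by (auto split: if_splits)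
    then show ?thesis by (metis bit_eq_rec)
  qed
qed

lemma inj_enc_nat: "inj enc_nat"
  by (rule injI) (rule enc_nat_inject)

section \<open>Transport along injective encodings\<close>

text \<open>By injectivity, consecutive arcs of a path in the image meet in the image of a single
  vertex, so the path can be pulled back.\<close>

lemma rtrancl_map_prod:
  assumes inj: "inj_on h A" and r: "r \<subseteq> A \<times> A" and a: "a \<in> A"
  shows "(map_prod h h ` r)\<^sup>* `` {h a} = h ` (r\<^sup>* `` {a})"
proof -
  have "\<exists>b \<in> A. y = h b \<and> (a, b) \<in> r\<^sup>*" if "(h a, y) \<in> (map_prod h h ` r)\<^sup>*" for y
    using that
  proof (induction rule: rtrancl_induct)
    case base
    then show ?case using a by blast
  next
    case (step y z)
    then obtain b where b: "b \<in> A" "y = h b" "(a, b) \<in> r\<^sup>*" by blast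
    obtain b' c where bc: "(b', c) \<in> r" "y = h b'" "z = h c" using step(2) by auto
    then have "b' = b" using b r inj by (auto dest: inj_onD)
    then show ?case using b bc r by (auto intro: rtrancl_into_rtrancl)
  qed
  moreover have "(h a, h b) \<in> (map_prod h h ` r)\<^sup>*" if "(a, b) \<in> r\<^sup>*" for b
    using that
  proof (induction rule: rtrancl_induct)
    case (step b c)
    then have "(h b, h c) \<in> map_prod h h ` r" by (force simp: map_prod_def)
    with step.IH show ?case by (rule rtrancl_into_rtrancl)
  qed simp
  ultimately show ?thesis by blast
qed

lemma nbrs_map: "inj h \<Longrightarrow> nbrs (map_prod h h ` E) (h ` C) = h ` nbrs E C"
  by (auto simp: nbrs_def image_iff dest: injD)

lemma avoiding_map: "inj h \<Longrightarrow> avoiding (map_prod h h ` E) (h ` X) = map_prod h h ` avoiding E X"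
  by (auto simp: avoiding_def image_iff dest: injD) (metis map_prod_simp)

lemma comp_of_map: "inj h \<Longrightarrow> comp_of (map_prod h h ` E) (h ` X) (h t) = h ` comp_of E X t"
  unfolding comp_of_def by (simp add: avoiding_map rtrancl_map_prod[of h UNIV])

lemma core_map: "inj h \<Longrightarrow> core (map_prod h h ` E) (h t) (h ` X) = h ` core E t X"
  by (simp add: core_def comp_of_map nbrs_map)

definition canon :: "data \<Rightarrow> data set \<Rightarrow> data" where
  "canon v S = enc_list (\<lambda>x. x) (rev (filter (\<lambda>x. x \<in> S) (elems v)))"

lemma elems_canon: "elems (canon v S) = rev (filter (\<lambda>x. x \<in> S) (elems v))"
  by (simp add: canon_def)

lemma dselect_eq_canon: "dselect v l = canon v (dset l)"
  by (simp add: elems_canon elems_dselect flip: elems_inject)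

lemma dcore_eq_canon: "dcore v e t x = canon v (core (dpairs e) t (dset x))"
  by (simp add: elems_canon elems_dcore flip: elems_inject)

lemma size_canon_le: "size (canon v S) \<le> size v"
proof -
  have "size (canon v S) = sum_list (map (\<lambda>x. size x + 1) (filter (\<lambda>x. x \<in> S) (elems v)))"
    by (simp add: size_elems[of "canon v S"] elems_canon rev_map[symmetric])
  also have "\<dots> \<le> size v" unfolding size_elems[of v] by (rule sum_list_filter_le_nat)
  finally show ?thesis .
qed

locale encoded_graph = st_graph V E s t for V :: "nat set" and E s t +
  fixes v e :: data
  assumes distinct_v: "distinct (elems v)" and dset_v: "dset v = enc_nat ` V"
    and dpairs_e: "dpairs e = map_prod enc_nat enc_nat ` E"
begin

definition tree_of :: "nat set \<Rightarrow> data" where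
  "tree_of S = canon v (enc_nat ` S)"

lemma dset_tree_of: "S \<subseteq> V \<Longrightarrow> dset (tree_of S) = enc_nat ` S"
  by (auto simp: tree_of_def elems_canon dset_v)

lemma distinct_tree_of: "distinct (elems (tree_of S))"
  by (simp add: tree_of_def elems_canon distinct_v)

lemma card_enc_nat_image: "card (enc_nat ` S) = card S"
  by (rule card_image) (rule inj_on_subset[OF inj_enc_nat subset_UNIV])

lemma length_tree_of: "S \<subseteq> V \<Longrightarrow> length (elems (tree_of S)) = card S"
  by (metis card_enc_nat_image distinct_card distinct_tree_of dset_tree_of)

lemma inj_on_tree_of: "inj_on tree_of (Pow V)"
  by (rule inj_onI) (metis PowD dset_tree_of inj_enc_nat inj_image_eq_iff)

lemma minsep_subset: "is_minsep S \<Longrightarrow> S \<subseteq> V"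
  by (auto simp: is_minsep_def is_sep_def)

abbreviation ctx :: data where
  "ctx \<equiv> Pair v (Pair e (enc_nat t))"

lemma nbrs_single: "nbrs (dpairs e) {enc_nat x} = enc_nat ` nbrs E {x}"
  using nbrs_map[OF inj_enc_nat, of E "{x}"] by (simp add: dpairs_e)

lemma dcore_eq_tree_of:
  "dset d = enc_nat ` X \<Longrightarrow> dcore v e (enc_nat t) d = tree_of (core E t X)"
  by (simp add: dcore_eq_canon tree_of_def dpairs_e core_map inj_enc_nat)

lemma dnext_eq:
  assumes "S \<subseteq> V" shows "dnext ctx (tree_of S) (enc_nat x) = tree_of (next_sep S x)"
  unfolding dnext_def next_sep_def
  by (simp, rule dcore_eq_tree_of) (simp add: nbrs_single dset_tree_of[OF assms] image_Un)

lemma dset_dround_tree_of: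
  assumes L: "dset l = tree_of ` L" and minsep: "\<And>S. S \<in> L \<Longrightarrow> is_minsep S"
  shows "dset (dround ctx l) = tree_of ` next_seps L"
proof -
  \<comment> \<open>\<open>nbrs\<close> omits \<open>x\<close> itself, so the test agrees with
    adjacency only for \<open>x \<noteq> t\<close>, which holds as separators avoid
    \<open>t\<close>.\<close>
  have cond: "enc_nat t \<in> nbrs (dpairs e) {enc_nat x} \<longleftrightarrow> (x, t) \<in> E" if "S \<in> L" "x \<in> S" for S x
  proof -
    have "x \<noteq> t" using that minsep by (auto simp: is_minsep_def is_sep_def)
    then show ?thesis
      unfolding nbrs_single inj_image_mem_iff[OF inj_enc_nat] by (auto simp: nbrs_def)
  qed
  have "(\<Union>x \<in> dset (tree_of S). if enc_nat t \<in> nbrs (dpairs e) {x} then {} else {dnext ctx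
      (tree_of S) x}) =
     (\<Union>x \<in> S. if (x, t) \<in> E then {} else {tree_of (next_sep S x)})" if S: "S \<in> L" for S
    unfolding dset_tree_of[OF minsep_subset[OF minsep[OF S]]] image_image
    by (rule SUP_cong[OF refl]) (simp add: cond[OF S] dnext_eq[OF minsep_subset[OF minsep[OF S]]])
  then have "(\<Union>S' \<in> dset l. \<Union>x \<in> dset S'.
     if enc_nat t \<in> nbrs (dpairs e) {x} then {} else {dnext ctx S' x}) =
     (\<Union>S \<in> L. \<Union>x \<in> S. if (x, t) \<in> E then {} else {tree_of (next_sep S x)})"
    unfolding L image_image by (rule SUP_cong[OF refl])
  also have "\<dots> = tree_of ` {next_sep S x | S x. S \<in> L \<and> x \<in> S \<and> (x, t) \<notin> E}"
    by (auto split: if_splits)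
  finally show ?thesis by (simp add: dset_dround L next_seps_def image_Un)
qed

definition start :: data where
  "start = Pair (dcore v e (enc_nat t) (dnbrs e (Pair (enc_nat s) Atom))) Atom"

lemma dround_iterate:
  "dset ((dround ctx ^^ i) start) = tree_of ` (next_seps ^^ i) {first_sep}"
  "distinct (elems ((dround ctx ^^ i) start))"
proof -
  show "distinct (elems ((dround ctx ^^ i) start))"
    by (induction i) (auto simp: distinct_dround start_def)
  show "dset ((dround ctx ^^ i) start) = tree_of ` (next_seps ^^ i) {first_sep}"
  proof (induction i)
    case 0
    show ?case by (simp add: start_def first_sep_def nbrs_single dcore_eq_tree_of)
  next
    case (Suc i)
    show ?case using dset_dround_tree_of[OF Suc] next_seps_iterate_minsep[of i] by auto
  qed
qed

lemma dset_denum: "dset (denum ctx (enc_nat s)) = tree_of ` {S. is_minsep S}"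
proof -
  have "length (elems v) = card V"
    using distinct_card[OF distinct_v] by (simp add: dset_v card_enc_nat_image)
  then have "denum ctx (enc_nat s) = (dround ctx ^^ card V) start"
    by (simp add: denum_def dfold_const start_def)
  then show ?thesis by (simp add: dround_iterate(1) next_seps_iterate)
qed

text \<open>Every iterate is a duplicate-free list of trees of minimal separators, each no larger
  than the vertex list.\<close>

lemma size_dround_iterate:
  "size ((dround ctx ^^ i) start) \<le> card {S. is_minsep S} * (size v + 1)"
proof -
  let ?l = "(dround ctx ^^ i) start"
  have fin: "finite {S. is_minsep S}"
    by (rule finite_subset[of _ "Pow V"]) (use minsep_subset finite_V in auto)
  have "card (dset ?l) \<le> card ((next_seps ^^ i) {first_sep})"
    unfolding dround_iterate(1) by (rule card_image_le[OF finite_subset[OF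
        next_seps_iterate_minsep fin]])
  also have "\<dots> \<le> card {S. is_minsep S}" by (rule card_mono[OF fin next_seps_iterate_minsep])
  finally have "card (dset ?l) \<le> card {S. is_minsep S}" .
  then have len: "length (elems ?l) \<le> card {S. is_minsep S}"
    using distinct_card[OF dround_iterate(2)[of i]] by simp
  have "size ?l = (\<Sum>x\<leftarrow>elems ?l. size x + 1)" by (rule size_elems)
  also have "\<dots> \<le> (\<Sum>x\<leftarrow>elems ?l. size v + 1)"
    by (rule sum_list_mono) (auto simp: dround_iterate(1) tree_of_def size_canon_le)
  also have "\<dots> = length (elems ?l) * (size v + 1)" by (simp add: sum_list_triv)
  also have "\<dots> \<le> card {S. is_minsep S} * (size v + 1)" using len by (rule mult_le_mono1)
  finally show ?thesis .
qed

text \<open>\<open>tree_of\<close> is injective on subsets of \<open>V\<close> and carries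
  \<open>links\<close> to the computed arcs, so reachability transfers in both directions.\<close>

lemma ddecide_correct:
  assumes A: "A \<subseteq> V" "dset a = enc_nat ` A" and B: "B \<subseteq> V" "dset b = enc_nat ` B"
    and k: "length (elems k) = k'" and m: "length (elems m) = m'"
  shows "ddecide ctx (enc_nat s) a b k m \<noteq> Atom \<longleftrightarrow> (A, B) \<in> (links k' m' A B)\<^sup>*"
proof -
  let ?n = "Pair (tree_of A) (Pair (tree_of B) (dkeep k (denum ctx (enc_nat s))))"
  have sel: "dselect v a = tree_of A" "dselect v b = tree_of B"
    by (simp_all add: dselect_eq_canon tree_of_def A B)
  have nodes_V: "S \<subseteq> V" if "S \<in> nodes k' A B" for S
    using that A B minsep_subset[of S] by (auto simp: nodes_def)
  have "dset ?n = tree_of ` nodes k' A B"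
    using length_tree_of[OF minsep_subset] by (auto simp: dset_dkeep dset_denum nodes_def k)
  moreover have "length (elems (dunion (tree_of X) (tree_of Y))) = card (X \<union> Y)" if "X \<subseteq> V" "Y \<subseteq>
      V" for X Y
  proof -
    have "length (elems (dunion (tree_of X) (tree_of Y))) = card (dset (dunion (tree_of X)
        (tree_of Y)))"
      by (rule distinct_card[symmetric]) (simp add: distinct_tree_of)
    also have "\<dots> = card (enc_nat ` (X \<union> Y))" using that by (simp add: dset_tree_of image_Un)
    finally show ?thesis by (simp only: card_enc_nat_image)
  qed
  ultimately have "dpairs (dlinks ?n m) = map_prod tree_of tree_of ` links k' m' A B"
    using nodes_V unfolding dpairs_dlinks links_def m by (fastforce simp: image_iff)
  moreover have "links k' m' A B \<subseteq> Pow V \<times> Pow V" using nodes_V by (auto simp: links_def)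
  ultimately have "dset (dreach (dlinks ?n m) (tree_of A)) = tree_of ` ((links k' m' A B)\<^sup>* `` {A})"
    using rtrancl_map_prod[OF inj_on_tree_of] A by simp
  then have "ddecide ctx (enc_nat s) a b k m \<noteq> Atom \<longleftrightarrow>
      tree_of B \<in> tree_of ` ((links k' m' A B)\<^sup>* `` {A})"
    by (simp add: ddecide_def sel)
  also have "\<dots> \<longleftrightarrow> B \<in> (links k' m' A B)\<^sup>* `` {A}"
  proof (rule inj_on_image_mem_iff[OF inj_on_tree_of])
    have "S \<in> Pow V" if "(A, S) \<in> (links k' m' A B)\<^sup>*" for S
      using that by (induction rule: rtrancl_induct) (use A nodes_V in \<open>auto simp: links_def\<close>)
    then show "(links k' m' A B)\<^sup>* `` {A} \<subseteq> Pow V" by blast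
  qed (use B in simp)
  finally show ?thesis by simp
qed

end

text \<open>All nodes and their unions lie in \<open>V\<close>, so no bound above
  \<open>card V\<close> can exclude anything.\<close>

lemma (in st_graph) links_min_card:
  assumes "A \<subseteq> V" "B \<subseteq> V"
  shows "links (min k (card V)) (min k (card V)) A B = links k k A B"
proof -
  have nodes: "nodes (min k (card V)) A B = nodes k A B"
    using card_mono[OF finite_V] by (auto simp: nodes_def is_minsep_def is_sep_def)
  have "card (X \<union> Y) \<le> card V" if "X \<in> nodes k A B" "Y \<in> nodes k A B" for X Y
    by (rule card_mono[OF finite_V]) (use that assms in \<open>auto simp: nodes_def is_minsep_def
        is_sep_def\<close>)
  then show ?thesis unfolding links_def nodes by auto
qed

text \<open>Horner's recursion replaces each real coefficient by a natural number above it, which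
  reduces the given polynomial to the form used by \<open>poly_bounded\<close>.\<close>

lemma real_poly_le_power:
  fixes p :: "real poly"
  obtains c where "\<And>n :: nat. poly p (real n) \<le> real ((n + 2) ^ c)"
proof -
  have "\<exists>c. \<forall>n :: nat. poly p (real n) \<le> real ((n + 2) ^ c)"
  proof (induction p)
    case 0
    then show ?case by (intro exI[of _ 0]) simp
  next
    case (pCons a p)
    then obtain c where c: "\<And>n :: nat. poly p (real n) \<le> real ((n + 2) ^ c)" by blast
    obtain j :: nat where j: "a \<le> real j" using real_arch_simple by blast
    have "poly (pCons a p) (real n) \<le> real ((n + 2) ^ (j + c + 2))" for n :: nat
    proof -
      have "poly (pCons a p) (real n) \<le> real j + real n * real ((n + 2) ^ c)"
        using j c[of n] by (auto intro!: add_mono mult_left_mono)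
      also have "\<dots> = real (j + n * (n + 2) ^ c)" by simp
      also have "\<dots> \<le> real ((n + 2) ^ (j + c + 2))"
      proof (rule of_nat_mono)
        have "j \<le> 2 ^ j" by (simp add: less_imp_le)
        also have "\<dots> \<le> (n + 2) ^ j" by (rule power_mono) auto
        also have "\<dots> \<le> (n + 2) ^ (j + c + 1)" by (rule power_increasing) auto
        finally have 1: "j \<le> (n + 2) ^ (j + c + 1)" .
        have "n * (n + 2) ^ c \<le> (n + 2) ^ Suc c" by simp
        also have "\<dots> \<le> (n + 2) ^ (j + c + 1)" by (rule power_increasing) auto
        finally have "j + n * (n + 2) ^ c \<le> 2 * (n + 2) ^ (j + c + 1)" using 1 by linarith
        also have "\<dots> \<le> (n + 2) ^ (j + c + 2)" by simp
        finally show "j + n * (n + 2) ^ c \<le> (n + 2) ^ (j + c + 2)" .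
      qed
      finally show ?thesis .
    qed
    then show ?case by blast
  qed
  then show thesis using that by blast
qed

lemma encoded_graphI:
  assumes "pair_graph G" "nonadjacent G s t"
    and v: "encodes_set enc_nat (pverts G) v" and e: "encodes_set enc_arc (parcs G) e"
  shows "encoded_graph (pverts G) (parcs G) s t v e"
proof -
  interpret st_graph "pverts G" "parcs G" s t using assms(1,2) by (rule st_graphI)
  show ?thesis
  proof
    show "distinct (elems v)" "dset v = enc_nat ` pverts G"
      using v inj_on_subset[OF inj_enc_nat subset_UNIV]
      by (auto simp: encodes_set_def distinct_map)
    obtain xs where "set xs = parcs G" "e = enc_list enc_arc xs"
      using e by (auto simp: encodes_set_def)
    then show "dpairs e = map_prod enc_nat enc_nat ` parcs G"
      by (force simp: dpairs_def enc_arc_def image_image)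
  qed
qed

lemma dset_encodes_set: "encodes_set f A d \<Longrightarrow> dset d = f ` A"
  by (auto simp: encodes_set_def)

lemma length_encodes_set: "encodes_set f A d \<Longrightarrow> length (elems d) = card A"
  by (auto simp: encodes_set_def distinct_card)

section \<open>The decision procedures for TJ and TAR\<close>

definition tj_ctx :: "data \<Rightarrow> data" where
  "tj_ctx d = Pair (left (left d)) (Pair (right (left d)) (left (right (right d))))"

definition tj_decide :: "data \<Rightarrow> data \<Rightarrow> data \<Rightarrow> data" where
  "tj_decide d k m = ddecide (tj_ctx d) (left (right d))
     (left (right (right (right d)))) (right (right (right (right d)))) k m"

lemma encodes_tjE:
  assumes "encodes_tj (G, s, t, A, B) d" "pair_graph G" "nonadjacent G s t"
  obtains v e a b where "encoded_graph (pverts G) (parcs G) s t v e"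
    "encodes_set enc_nat A a" "encodes_set enc_nat B b" "encodes_set enc_nat (pverts G) v"
    "d = Pair (Pair v e) (Pair (enc_nat s) (Pair (enc_nat t) (Pair a b)))"
  using assms encoded_graphI by (auto simp: encodes_graph_def)

lemma tj_decide_correct:
  assumes d: "encodes_tj (G, s, t, A, B) d" and G: "pair_graph G" "nonadjacent G s t"
    and A: "separator G s t A" and B: "separator G s t B"
  shows "tj_decide d k m \<noteq> Atom \<longleftrightarrow>
    (A, B) \<in> (st_graph.links (pverts G) (parcs G) s t (length (elems k)) (length (elems m)) A B)\<^sup>*"
proof -
  obtain v e a b where enc: "encoded_graph (pverts G) (parcs G) s t v e"
    "encodes_set enc_nat A a" "encodes_set enc_nat B b"
    and d: "d = Pair (Pair v e) (Pair (enc_nat s) (Pair (enc_nat t) (Pair a b)))"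
    using encodes_tjE[OF d G] by metis
  interpret encoded_graph "pverts G" "parcs G" s t v e by (rule enc(1))
  show ?thesis
    using ddecide_correct[OF _ dset_encodes_set[OF enc(2)] _ dset_encodes_set[OF enc(3)]] A B
    by (simp add: tj_decide_def tj_ctx_def d separator_def subset_iff)
qed

text \<open>\<open>f\<close> extracts the part of the input common to both problems. Confining
  \<open>D\<close> to encodings of graphs in the class bounds every stage of the
  enumeration.\<close>

lemma ptime_tj_decide:
  fixes \<G> :: "nat pair_pre_digraph set" and p :: "real poly"
  assumes G: "\<And>G. G \<in> \<G> \<Longrightarrow> pair_graph G"
    and p: "\<forall>G \<in> \<G>. real (card (minimal_vertex_separators G)) \<le> poly p (real (card (pverts G)))"
    and f: "ptime D f" and k: "ptime D k" and m: "ptime D m"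
    and D: "\<And>d. d \<in> D \<Longrightarrow> \<exists>G s t A B. G \<in> \<G> \<and> nonadjacent G s t \<and> encodes_tj (G, s, t, A, B) (f d)"
  shows "ptime D (\<lambda>d. tj_decide (f d) (k d) (m d))"
proof -
  obtain c where c: "\<And>n :: nat. poly p (real n) \<le> real ((n + 2) ^ c)"
    using real_poly_le_power by blast
  define M where "M d = (size (f d) + 2) ^ c * (size (f d) + 1)" for d
  have "ptime D (\<lambda>d. denum (tj_ctx (f d)) (left (right (f d))))"
  proof (rule ptime_denum)
    show "ptime D (\<lambda>d. tj_ctx (f d))" unfolding tj_ctx_def by (intro ptime_intros f)
    show "ptime D (\<lambda>d. left (right (f d)))" by (intro ptime_intros f)
    show "poly_bounded D M" unfolding M_def by (intro poly_bounded_intros ptime_size f)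
    fix d i assume "d \<in> D"
    then obtain G s t A B where GG: "G \<in> \<G>" "nonadjacent G s t" "encodes_tj (G, s, t, A, B) (f d)"
      using D by metis
    obtain v e a b where enc: "encoded_graph (pverts G) (parcs G) s t v e"
      "encodes_set enc_nat (pverts G) v"
      and d: "f d = Pair (Pair v e) (Pair (enc_nat s) (Pair (enc_nat t) (Pair a b)))"
      using encodes_tjE[OF GG(3) G[OF GG(1)] GG(2)] by metis
    interpret encoded_graph "pverts G" "parcs G" s t v e by (rule enc(1))
    \<comment> \<open>The separators for this one pair are among those counted for the whole graph,
      so the bound of the class applies to them.\<close>
    have "{S. is_minsep S} \<subseteq> minimal_vertex_separators G"
      unfolding minimal_vertex_separators_def
        minimal_separator_iff_is_minsep[OF G[OF GG(1)] GG(2), symmetric]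
      using GG(2) by blast
    moreover have "minimal_vertex_separators G \<subseteq> Pow (pverts G)"
      by (auto simp: minimal_vertex_separators_def minimal_separator_def separator_def)
    ultimately have "card {S. is_minsep S} \<le> card (minimal_vertex_separators G)"
      using finite_V by (meson card_mono finite_Pow_iff finite_subset)
    also have "\<dots> \<le> (card (pverts G) + 2) ^ c"
      using p GG(1) c[of "card (pverts G)"] by (metis of_nat_le_iff order_trans)
    also have "\<dots> \<le> (size v + 2) ^ c"
      using length_elems_le[of v] length_encodes_set[OF enc(2)] by (intro power_mono) auto
    finally have "card {S. is_minsep S} * (size v + 1) \<le> (size v + 2) ^ c * (size v + 1)"
      by (rule mult_le_mono1)
    also have "\<dots> \<le> M d" unfolding M_def by (intro mult_mono power_mono) (auto simp: d)
    finally have "size ((dround ctx ^^ i) start) \<le> M d" using size_dround_iterate[of i] by linarith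
    then show "size ((dround (tj_ctx (f d)) ^^ i) (Pair (dcore (left (tj_ctx (f d))) (left (right
        (tj_ctx (f d))))
       (right (right (tj_ctx (f d)))) (dnbrs (left (right (tj_ctx (f d)))) (Pair (left (right (f
           d))) Atom))) Atom)) \<le> M d"
      by (simp add: tj_ctx_def d start_def)
  qed
  then show ?thesis unfolding tj_decide_def
    by (rule ptime_ddecide) (unfold tj_ctx_def, (intro ptime_intros f k m)+)
qed

theorem theorem3:
  fixes \<G> :: "nat pair_pre_digraph set"
  assumes "\<And>G. G \<in> \<G> \<Longrightarrow> pair_graph G"
    and "\<exists>p :: real poly. \<forall>G \<in> \<G>.
           real (card (minimal_vertex_separators G)) \<le> poly p (real (card (pverts G)))"
  shows "poly_time_solvable (tar_instances \<G>) encodes_tar tar_yes \<and>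
         poly_time_solvable (tj_instances \<G>) encodes_tj tj_yes"
proof
  obtain p :: "real poly" where p: "\<forall>G \<in> \<G>.
      real (card (minimal_vertex_separators G)) \<le> poly p (real (card (pverts G)))"
    using assms(2) by blast
  show "poly_time_solvable (tj_instances \<G>) encodes_tj tj_yes"
  proof (rule poly_time_solvableI)
    let ?D = "{d. \<exists>i \<in> tj_instances \<G>. encodes_tj i d}"
    let ?a = "\<lambda>d. left (right (right (right d)))"
    \<comment> \<open>The list encoding \<open>A\<close> serves as a unary \<open>k\<close>; one
      more cell gives \<open>k + 1\<close>.\<close>
    show "ptime ?D (\<lambda>d. tj_decide d (?a d) (Pair Atom (?a d)))"
    proof (rule ptime_tj_decide[OF assms(1) p])
      fix d assume "d \<in> ?D"
      then show "\<exists>G s t A B. G \<in> \<G> \<and> nonadjacent G s t \<and> encodes_tj (G, s, t, A, B) d"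
        unfolding tj_instances_def by blast
    qed (assumption | intro ptime_intros)+
    fix i d assume i: "i \<in> tj_instances \<G>" and d: "encodes_tj i d"
    obtain G s t A B where [simp]: "i = (G, s, t, A, B)" by (cases i)
    have G: "pair_graph G" "nonadjacent G s t" and A: "separator G s t A" and B: "separator G s t B"
      and card: "card A = card B"
      using i assms(1) by (auto simp: tj_instances_def)
    interpret st_graph "pverts G" "parcs G" s t using G by (rule st_graphI)
    have sep: "is_sep A" "is_sep B" using A B unfolding separator_iff_is_sep[OF G] .
    have len: "length (elems (?a d)) = card A"
      using d length_encodes_set by auto
    have "tj_decide d (?a d) (Pair Atom (?a d)) \<noteq> Atom \<longleftrightarrow> (A, B) \<in> (links (card A) (card A + 1) A
        B)\<^sup>*"
      using tj_decide_correct[of G s t A B d] d G A B by (simp add: len)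
    also have "\<dots> \<longleftrightarrow> tj_yes i"
      using tj_iff_links[OF sep(1) refl sep(2)] card reconfigurable_iff_sep_step[OF G A, of
          tj_adjacent B]
      by simp
    finally show "d \<in> ?D \<and> (tj_decide d (?a d) (Pair Atom (?a d)) \<noteq> Atom \<longleftrightarrow> tj_yes i)"
      using i d by blast
  qed
  show "poly_time_solvable (tar_instances \<G>) encodes_tar tar_yes"
  proof (rule poly_time_solvableI)
    let ?D = "{d. \<exists>i \<in> tar_instances \<G>. encodes_tar i d}"
    \<comment> \<open>For TAR the bound arrives in binary and is turned into a capped unary list,
      used for both nodes and unions.\<close>
    let ?k = "\<lambda>d. dcap (left (left (right d))) (left d)"
    show "ptime ?D (\<lambda>d. tj_decide (right d) (?k d) (?k d))"
    proof (rule ptime_tj_decide[OF assms(1) p])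
      fix d assume "d \<in> ?D"
      then show "\<exists>G s t A B. G \<in> \<G> \<and> nonadjacent G s t \<and> encodes_tj (G, s, t, A, B) (right d)"
        unfolding tar_instances_def by fastforce
    qed (assumption | intro ptime_intros ptime_dcap)+
    fix i d assume i: "i \<in> tar_instances \<G>" and d: "encodes_tar i d"
    obtain G s t A B k where [simp]: "i = (G, s, t, A, B, k)" by (cases i)
    have G: "pair_graph G" "nonadjacent G s t" and A: "separator G s t A" and B: "separator G s t B"
      and card: "card A \<le> k" "card B \<le> k"
      using i assms(1) by (auto simp: tar_instances_def)
    interpret st_graph "pverts G" "parcs G" s t using G by (rule st_graphI)
    have sep: "is_sep A" "is_sep B" using A B unfolding separator_iff_is_sep[OF G] .
    obtain d' where d': "encodes_tj (G, s, t, A, B) d'" "d = Pair (enc_nat k) d'"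
      using d by auto
    have len: "length (elems (?k d)) = min k (card (pverts G))"
      using d' by (auto simp: encodes_graph_def length_dcap dest: length_encodes_set)
    have V: "A \<subseteq> pverts G" "B \<subseteq> pverts G" using A B by (auto simp: separator_def)
    have "tj_decide (right d) (?k d) (?k d) \<noteq> Atom \<longleftrightarrow>
        (A, B) \<in> (links (length (elems (?k d))) (length (elems (?k d))) A B)\<^sup>*"
      by (rule tj_decide_correct[OF _ G A B]) (use d' in simp)
    also have "\<dots> \<longleftrightarrow> (A, B) \<in> (links k k A B)\<^sup>*"
      by (simp only: len links_min_card[OF V])
    also have "\<dots> \<longleftrightarrow> tar_yes i"
      using tar_iff_links[OF sep(1) card(1) sep(2) card(2)]
        reconfigurable_iff_sep_step[OF G A, of "tar_adjacent k" B] by simp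
    finally show "d \<in> ?D \<and> (tj_decide (right d) (?k d) (?k d) \<noteq> Atom \<longleftrightarrow> tar_yes i)"
      using i d by blast
  qed
qed

end
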